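(* Let $\mu=ID(A,L,b)_h$ be an infinitely divisible distribution on $\mathbb R^d$, and let $g:\mathbb R^d\to[0,\infty)$ be a Borel function such that (A1) $0\le g(x)\le1$ for all $x\in\mathbb R^d$, and (A2) $\int_{\mathbb R^d}\left(|xh(x)|\vee1\right)(1-g(x))\,L(\mathrm dx)<\infty$. Let $\tilde\mu=ID(A,\tilde L,\tilde b)_h$ with $\tilde L(\mathrm dx)=g(x)L(\mathrm dx)$ and $\tilde b=b-\int_{\mathbb R^d}xh(x)(1-g(x))\,L(\mathrm dx)$, and let $\eta=\int_{\mathbb R^d}(1-g(x))\,L(\mathrm dx)<\infty$. Let $\{X_t:t\ge0\}$ and $\{\tilde X_t:t\ge0\}$ be L\'evy processes with $X_1\sim\mu$ and $\tilde X_1\sim\tilde\mu$. Fix $t>0$ and suppose that the distributions of $X_t$ and $\tilde X_t$ are absolutely continuous with respect to Lebesgue measure on $\mathbb R^d$, with densities $f_t$ and $\tilde f_t$ respectively. Then $$\tilde f_t(x)\le e^{t\eta}f_t(x)\quad\text{for Lebesgue almost every }x\in\mathbb R^d.$$ Consequently, consider the following procedure, in which all iterations are independent. Step 1: independently simulate $U$ uniformly distributed on $(0,1)$ and $Y$ with density $f_t$. Step 2: if $U\le e^{-\eta t}\tilde f_t(Y)/f_t(Y)$, accept and return $Y$; otherwise reject and go back to Step 1. The returned value has density $\tilde f_t$, the probability of acceptance on a given iteration is $p_t=e^{-\eta t}$, and the expected number of iterations until the first acceptance is $I_t=e^{\eta t}$.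
   Context: $\mathbb R^d$ carries the usual inner product $\langle\cdot,\cdot\rangle$ and norm $|\cdot|$; $a\vee b=\max(a,b)$, $a\wedge b=\min(a,b)$; $X\sim\mu$ means $X$ has distribution $\mu$. $ID(A,L,b)_h$ denotes the infinitely divisible probability measure on $\mathbb R^d$ with characteristic function $\phi_\mu(z)=\exp\{C_\mu(z)\}$, where $$C_\mu(z)=-\tfrac12\langle z,Az\rangle+i\langle b,z\rangle+\int_{\mathbb R^d}\left(e^{i\langle z,x\rangle}-1-i\langle z,x\rangle h(x)\right)L(\mathrm dx),\quad z\in\mathbb R^d.$$ Here $A$ is a symmetric nonnegative-definite $d\times d$ matrix, $b\in\mathbb R^d$, $L$ is a Borel measure on $\mathbb R^d$ with $L(\{0\})=0$ and $\int_{\mathbb R^d}(|x|^2\wedge1)L(\mathrm dx)<\infty$, and $h:\mathbb R^d\to\mathbb R$ is a Borel function with $\int_{\mathbb R^d}|e^{i\langle z,x\rangle}-1-i\langle z,x\rangle h(x)|L(\mathrm dx)<\infty$ for all $z\in\mathbb R^d$. Under (A1), $\tilde L$ is a valid L\'evy measure and the same $h$ can be used with $\tilde L$. A L\'evy process $\{X_t:t\ge0\}$ with $X_1\sim\mu$ starts at $0$, is stochastically continuous, has independent and stationary increments, and $X_t$ has characteristic function $(\phi_\mu(z))^t$. *)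

theory Defs
  imports "HOL-Probability.Probability"
begin

definition levy_measure :: "'a::euclidean_space measure \<Rightarrow> bool" where
  "levy_measure L \<longleftrightarrow>
     sets L = sets borel \<and> emeasure L {0} = 0 \<and>
     (\<integral>\<^sup>+ x. ennreal (min ((norm x)\<^sup>2) 1) \<partial>L) < \<infinity>"

definition levy_integrand ::
  "('a::euclidean_space \<Rightarrow> real) \<Rightarrow> 'a \<Rightarrow> 'a \<Rightarrow> complex" where
  "levy_integrand h z x = iexp (z \<bullet> x) - 1 - \<i> * complex_of_real ((z \<bullet> x) * h x)"

definition levy_exponent ::
  "real ^ 'n ^ 'n \<Rightarrow> (real ^ 'n) measure \<Rightarrow> real ^ 'n \<Rightarrow> (real ^ 'n \<Rightarrow> real) \<Rightarrow>
   real ^ 'n \<Rightarrow> complex" where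
  "levy_exponent A L b h z =
     - complex_of_real ((z \<bullet> (A *v z)) / 2) + \<i> * complex_of_real (b \<bullet> z)
     + (CLINT x|L. levy_integrand h z x)"

text \<open>The library constant \<open>char\<close> only covers measures on the real line.\<close>

definition char_fun :: "'a::euclidean_space measure \<Rightarrow> 'a \<Rightarrow> complex" where
  "char_fun \<mu> z = (CLINT x|\<mu>. iexp (z \<bullet> x))"

text \<open>
  \<open>ID_law \<mu> A L b h\<close> says that \<open>(A, L, b)\<close> and \<open>h\<close> are admissible and that \<open>\<mu>\<close> is the law
  \<open>ID(A,L,b)\<close> with truncation function \<open>h\<close>. Such a \<open>\<mu>\<close> is unique and infinitely divisible
  by its characteristic function.
\<close>

definition ID_law ::
  "(real ^ 'n) measure \<Rightarrow> real ^ 'n ^ 'n \<Rightarrow> (real ^ 'n) measure \<Rightarrow> real ^ 'n \<Rightarrow>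
   (real ^ 'n \<Rightarrow> real) \<Rightarrow> bool" where
  "ID_law \<mu> A L b h \<longleftrightarrow>
     transpose A = A \<and> (\<forall>z. 0 \<le> z \<bullet> (A *v z)) \<and>
     levy_measure L \<and>
     h \<in> borel_measurable borel \<and> (\<forall>z. integrable L (levy_integrand h z)) \<and>
     prob_space \<mu> \<and> sets \<mu> = sets borel \<and>
     (\<forall>z. char_fun \<mu> z = exp (levy_exponent A L b h z))"

text \<open>Only the values \<open>X t\<close> with \<open>0 \<le> t\<close> matter.\<close>

locale levy_process = prob_space M
  for M :: "'w measure" and X :: "real \<Rightarrow> 'w \<Rightarrow> 'a::euclidean_space" +
  assumes rv: "\<And>t. 0 \<le> t \<Longrightarrow> random_variable borel (X t)"
    and start: "AE \<omega> in M. X 0 \<omega> = 0"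
    and stoch_continuous: "\<And>t \<epsilon>. 0 \<le> t \<Longrightarrow> 0 < \<epsilon> \<Longrightarrow>
      ((\<lambda>s. prob {\<omega> \<in> space M. norm (X s \<omega> - X t \<omega>) > \<epsilon>}) \<longlongrightarrow> 0) (at t within {0..})"
    and indep_increments: "\<And>(n::nat) \<tau>. 0 \<le> \<tau> 0 \<Longrightarrow> (\<forall>i<n. \<tau> i < \<tau> (Suc i)) \<Longrightarrow>
      indep_vars (\<lambda>_. borel) (\<lambda>i \<omega>. X (\<tau> (Suc i)) \<omega> - X (\<tau> i) \<omega>) {..<n}"
    and stationary_increments: "\<And>s t. 0 \<le> s \<Longrightarrow> 0 \<le> t \<Longrightarrow>
      distr M borel (\<lambda>\<omega>. X (s + t) \<omega> - X s \<omega>) = distr M borel (\<lambda>\<omega>. X t \<omega> - X 0 \<omega>)"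

text \<open>
  Inputs of the rejection procedure: in iteration \<open>n\<close>, the variables \<open>U n\<close> and \<open>Y n\<close> are
  drawn. The library's \<open>indep_var\<close> requires both variables to have the same range type, so
  independence within an iteration is stated for the generated \<open>\<sigma>\<close>-algebras.
\<close>

locale rejection_inputs = prob_space P
  for P :: "'p measure" and U :: "nat \<Rightarrow> 'p \<Rightarrow> real"
    and Y :: "nat \<Rightarrow> 'p \<Rightarrow> 'a::euclidean_space" and f :: "'a \<Rightarrow> real" +
  assumes U_uniform: "\<And>n. distributed P lborel (U n) (indicator {0<..<1})"
    and Y_density: "\<And>n. distributed P lborel (Y n) (\<lambda>x. ennreal (f x))"
    and indep_within: "\<And>n. indep_set
      {U n -` B \<inter> space P | B. B \<in> sets borel} {Y n -` B \<inter> space P | B. B \<in> sets borel}"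
    and indep_iterations:
      "indep_vars (\<lambda>_. borel \<Otimes>\<^sub>M borel) (\<lambda>n \<omega>. (U n \<omega>, Y n \<omega>)) UNIV"

text \<open>
  The case \<open>f (Y n \<omega>) = 0\<close>, where the quotient is \<open>0\<close> by convention, has probability zero.
\<close>

definition accepts ::
  "real \<Rightarrow> ('a \<Rightarrow> real) \<Rightarrow> ('a \<Rightarrow> real) \<Rightarrow> (nat \<Rightarrow> 'p \<Rightarrow> real) \<Rightarrow> (nat \<Rightarrow> 'p \<Rightarrow> 'a) \<Rightarrow>
   nat \<Rightarrow> 'p \<Rightarrow> bool" where
  "accepts c f' f U Y n \<omega> \<longleftrightarrow> U n \<omega> \<le> c * f' (Y n \<omega>) / f (Y n \<omega>)"

text \<open>
  The first acceptance, and the number of iterations up to and including it. The latter is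
  \<open>\<infinity>\<close> if the procedure never accepts, so that a finite expectation entails almost sure
  termination; the former is then an arbitrary fixed index.
\<close>

definition returned_value ::
  "(nat \<Rightarrow> 'p \<Rightarrow> bool) \<Rightarrow> (nat \<Rightarrow> 'p \<Rightarrow> 'a) \<Rightarrow> 'p \<Rightarrow> 'a" where
  "returned_value acc Y \<omega> = Y (LEAST n. acc n \<omega>) \<omega>"

definition num_iterations :: "(nat \<Rightarrow> 'p \<Rightarrow> bool) \<Rightarrow> 'p \<Rightarrow> ennreal" where
  "num_iterations acc \<omega> = (INF n \<in> {n. acc n \<omega>}. of_nat (Suc n))"

end

theory Submission
  imports Defs
begin

text \<open>
  The exponents of the two Levy processes differ by the integral of \<open>exp (i z x) - 1\<close> against the
  finite measure \<open>(1 - g) L\<close> (lemma \<open>levy_exponent_thinning\<close>). So \<open>X t\<close> has the law of a sum of two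
  independent variables, one distributed like \<open>Xt t\<close> and the other compound Poisson: \<open>X\<close> arises from
  \<open>Xt\<close> by adding back the jumps that thinning removed. With probability \<open>exp (- t \<eta>)\<close> there is no such
  jump before time \<open>t\<close>. Therefore the law of \<open>X t\<close> dominates \<open>exp (- t \<eta>)\<close> times the law of \<open>Xt t\<close>
  (lemma \<open>levy_thinning_domination\<close>), and for absolutely continuous laws this is the asserted
  inequality of densities.

  Two facts support this argument. A finite measure on Euclidean space is determined by
  its characteristic function (\<open>finite_measure_eqI_char_fun\<close>); this follows from the
  one-dimensional case by treating one coordinate at a time, with the remaining frequencies
  carried along as weights. And the characteristic function of \<open>X t\<close> is the \<open>t\<close>-th power
  \<open>exp (t \<Psi>)\<close> of that of \<open>X 1\<close> (\<open>char_fun_levy_process\<close>), where the correct branch of the power comes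
  from continuity along the segment from \<open>0\<close> to \<open>z\<close>.

  The statements about the procedure are general properties of rejection sampling. The accepted
  part of the law of one proposal is \<open>c = exp (- \<eta> t)\<close> times the target law, by the density
  inequality; independence of the iterations turns this into geometric series for the law of the
  returned value and for the expected number of iterations.
\<close>

section \<open>Characteristic functions determine finite measures on Euclidean space\<close>

lemma (in finite_measure) prob_space_normalize:
  assumes "measure M (space M) \<noteq> 0"
  shows "prob_space (density M (\<lambda>_. ennreal (1 / measure M (space M))))"
proof
  have "0 < measure M (space M)" using assms by (simp add: less_le)
  then show "emeasure (density M (\<lambda>_. ennreal (1 / measure M (space M))))
      (space (density M (\<lambda>_. ennreal (1 / measure M (space M))))) = 1"
    by (simp add: emeasure_density emeasure_eq_measure flip: ennreal_mult)
qed

text \<open>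
  Levy's uniqueness theorem for probability measures extends to finite measures by
  normalisation, because the total mass is the value of the characteristic function at \<open>0\<close>.
  The extension is needed for image measures with a weight, whose mass is not \<open>1\<close>.
\<close>

lemma finite_measure_eqI_char:
  fixes M N :: "real measure"
  assumes M: "finite_measure M" "sets M = sets borel"
    and N: "finite_measure N" "sets N = sets borel"
    and eq: "\<And>s. char M s = char N s"
  shows "M = N"
proof -
  interpret M: finite_measure M by fact
  interpret N: finite_measure N by fact
  note [measurable_cong] = M(2) N(2)
  have sp: "space M = UNIV" "space N = UNIV"
    using sets_eq_imp_space_eq[OF M(2)] sets_eq_imp_space_eq[OF N(2)] by auto
  define m where "m = measure M UNIV"
  have mass: "measure N UNIV = m"
    using eq[of 0] by (simp add: char_def sp m_def)
  show ?thesis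
  proof (cases "m = 0")
    case True
    then have "emeasure M UNIV = 0" "emeasure N UNIV = 0"
      using mass by (simp_all add: m_def M.emeasure_eq_measure N.emeasure_eq_measure)
    then have "emeasure M A = 0" "emeasure N A = 0" if "A \<in> sets borel" for A
      using emeasure_mono[of A UNIV M] emeasure_mono[of A UNIV N] that sp M(2) N(2) by auto
    then show ?thesis using M(2) N(2) by (intro measure_eqI) auto
  next
    case False
    then have "0 < m" by (simp add: m_def less_le)
    let ?M = "density M (\<lambda>_. ennreal (1 / m))" and ?N = "density N (\<lambda>_. ennreal (1 / m))"
    interpret UM: prob_space ?M using M.prob_space_normalize False by (simp add: sp m_def)
    interpret UN: prob_space ?N using N.prob_space_normalize False by (simp add: sp mass)
    have "?M = ?N"
    proof (rule Levy_uniqueness)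
      show "real_distribution ?M" by unfold_locales (simp add: M)
      show "real_distribution ?N" by unfold_locales (simp add: N)
      have "char ?M s = char M s / m" for s
        unfolding char_def using \<open>0 < m\<close>
        by (subst integral_density) (auto simp: scaleR_conv_of_real)
      moreover have "char ?N s = char N s / m" for s
        unfolding char_def using \<open>0 < m\<close>
        by (subst integral_density) (auto simp: scaleR_conv_of_real)
      ultimately show "char ?M = char ?N" using eq by auto
    qed
    show ?thesis
    proof (rule measure_eqI)
      fix A assume "A \<in> sets M"
      then have A: "A \<in> sets M" "A \<in> sets N" using M N by auto
      have *: "ennreal m * (ennreal (1 / m) * x) = x" for x
        using \<open>0 < m\<close> by (simp add: mult.assoc[symmetric] flip: ennreal_mult)
      have "emeasure M A = ennreal m * emeasure ?M A"
        using A by (simp add: emeasure_density nn_integral_cmult_indicator *)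
      also have "\<dots> = ennreal m * emeasure ?N A" by (simp only: \<open>?M = ?N\<close>)
      also have "\<dots> = emeasure N A"
        using A by (simp add: emeasure_density nn_integral_cmult_indicator *)
      finally show "emeasure M A = emeasure N A" .
    qed (simp add: M N)
  qed
qed

text \<open>
  Multiplication by the weight \<open>G\<close> and projection to the direction \<open>w\<close> turn both measures into
  finite measures on the line, and the hypothesis says that these have the same characteristic
  function. So the one-dimensional theorem applies, one direction at a time.
\<close>

lemma halfspace_integral_eqI:
  fixes M N :: "'a::euclidean_space measure" and G :: "'a \<Rightarrow> real"
  assumes M: "finite_measure M" "sets M = sets borel"
    and N: "finite_measure N" "sets N = sets borel"
    and G: "G \<in> borel_measurable borel" "\<And>x. 0 \<le> G x" "\<And>x. G x \<le> K"
    and eq: "\<And>s. (CLINT x|M. G x * iexp (s * (w \<bullet> x))) = (CLINT x|N. G x * iexp (s * (w \<bullet> x)))"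
  shows "(LINT x|M. G x * indicator {x. w \<bullet> x \<le> a} x) = (LINT x|N. G x * indicator {x. w \<bullet> x \<le> a} x)"
proof -
  note [measurable] = G(1)
  let ?D = "\<lambda>M. distr (density M (\<lambda>x. ennreal (G x))) borel (\<lambda>x. w \<bullet> x)"
  have *: "finite_measure (?D M) \<and> (\<forall>s. char (?D M) s = (CLINT x|M. G x * iexp (s * (w \<bullet> x))))
      \<and> emeasure (?D M) {..a} = ennreal (LINT x|M. G x * indicator {x. w \<bullet> x \<le> a} x)"
    if M: "finite_measure M" and [measurable_cong]: "sets M = sets borel" for M
  proof -
    interpret finite_measure M by fact
    have fin: "(\<integral>\<^sup>+x. ennreal (G x) \<partial>M) < \<infinity>"
    proof -
      have "(\<integral>\<^sup>+x. ennreal (G x) \<partial>M) \<le> (\<integral>\<^sup>+x. ennreal K \<partial>M)"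
        using G by (intro nn_integral_mono) (auto simp: ennreal_leI)
      also have "\<dots> < \<infinity>" by (simp add: ennreal_mult_less_top emeasure_eq_measure)
      finally show ?thesis .
    qed
    have "emeasure (density M (\<lambda>x. ennreal (G x))) (space M) = (\<integral>\<^sup>+x. ennreal (G x) \<partial>M)"
      by (auto simp: emeasure_density intro!: nn_integral_cong)
    then interpret D: finite_measure "density M (\<lambda>x. ennreal (G x))"
      using fin by (intro finite_measureI) simp
    have "finite_measure (?D M)" by (intro D.finite_measure_distr) simp
    moreover have "char (?D M) s = (CLINT x|M. G x * iexp (s * (w \<bullet> x)))" for s
      unfolding char_def using G
      by (simp add: integral_distr integral_density scaleR_conv_of_real)
    moreover have "emeasure (?D M) {..a} = ennreal (LINT x|M. G x * indicator {x. w \<bullet> x \<le> a} x)"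
    proof -
      have "emeasure (?D M) {..a} = (\<integral>\<^sup>+x. ennreal (G x * indicator {x. w \<bullet> x \<le> a} x) \<partial>M)"
        by (subst emeasure_distr)
           (auto simp: emeasure_density intro!: nn_integral_cong split: split_indicator)
      also have "\<dots> = ennreal (LINT x|M. G x * indicator {x. w \<bullet> x \<le> a} x)"
        using G by (intro nn_integral_eq_integral integrable_const_bound[where B=K])
          (auto split: split_indicator intro: order_trans)
      finally show ?thesis .
    qed
    ultimately show ?thesis by blast
  qed
  have "?D M = ?D N"
    using *[OF M] *[OF N] eq by (intro finite_measure_eqI_char) auto
  then have "ennreal (LINT x|M. G x * indicator {x. w \<bullet> x \<le> a} x)
      = ennreal (LINT x|N. G x * indicator {x. w \<bullet> x \<le> a} x)"
    using *[OF M] *[OF N] by simp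
  then show ?thesis
    using G by (subst (asm) ennreal_inj) (auto intro!: integral_nonneg_AE)
qed

text \<open>
  A trigonometric weight only shifts the frequency. This is how the real and nonnegative weights
  that the one-dimensional theorem accepts encode a complex factor \<open>iexp (z \<bullet> x)\<close>: the weights
  \<open>1 + cos\<close> and \<open>1 + sin\<close> are nonnegative, and the weight \<open>1\<close> can be subtracted afterwards.
\<close>

lemma iexp_mult_cos:
  "complex_of_real (f * (1 + cos b)) * iexp a =
    f * iexp a + 1/2 * (f * iexp (a + b)) + 1/2 * (f * iexp (a - b))"
proof -
  have "iexp (a + b) = iexp a * iexp b" "iexp (a - b) = iexp a * iexp (- b)"
    by (simp_all only: exp_add[symmetric] of_real_add of_real_diff of_real_minus ring_distribs) simp_all
  moreover have "complex_of_real (cos b) = (iexp b + iexp (- b)) / 2"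
    unfolding cos_of_real[symmetric] cos_exp_eq by simp
  moreover have "(F * (1 + (p + q) / 2)) * e = F * e + 1/2 * (F * (e * p)) + 1/2 * (F * (e * q))"
    for F p q e :: complex by (simp add: field_simps)
  ultimately show ?thesis by (simp only: of_real_mult of_real_add of_real_1)
qed

lemma iexp_mult_sin:
  "complex_of_real (f * (1 + sin b)) * iexp a =
    f * iexp a + (-\<i>/2) * (f * iexp (a + b)) + \<i>/2 * (f * iexp (a - b))"
proof -
  have "iexp (a + b) = iexp a * iexp b" "iexp (a - b) = iexp a * iexp (- b)"
    by (simp_all only: exp_add[symmetric] of_real_add of_real_diff of_real_minus ring_distribs) simp_all
  moreover have "complex_of_real (sin b) = - \<i> * (iexp b - iexp (- b)) / 2"
    unfolding sin_of_real[symmetric] sin_exp_eq by (simp add: field_simps)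
  moreover have "(F * (1 + - \<i> * (p - q) / 2)) * e = F * e + (-\<i>/2) * (F * (e * p)) + \<i>/2 * (F * (e * q))"
    for F p q e :: complex by (simp add: field_simps)
  ultimately show ?thesis by (simp only: of_real_mult of_real_add of_real_1)
qed

text \<open>
  Equality of the Fourier transforms of \<open>F M\<close> and \<open>F N\<close> survives multiplication of \<open>F\<close> by the
  indicator of a half-space. The conclusion has the form of the hypothesis, for every frequency
  \<open>z\<close>, so that the step can be repeated with further half-spaces.
\<close>

lemma halfspace_fourier_eqI:
  fixes M N :: "'a::euclidean_space measure" and F :: "'a \<Rightarrow> real"
  assumes M: "finite_measure M" "sets M = sets borel"
    and N: "finite_measure N" "sets N = sets borel"
    and F: "F \<in> borel_measurable borel" "\<And>x. 0 \<le> F x" "\<And>x. F x \<le> 1"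
    and eq: "\<And>z. (CLINT x|M. F x * iexp (z \<bullet> x)) = (CLINT x|N. F x * iexp (z \<bullet> x))"
  shows "(CLINT x|M. of_real (F x * indicator {x. w \<bullet> x \<le> a} x) * iexp (z \<bullet> x)) =
    (CLINT x|N. of_real (F x * indicator {x. w \<bullet> x \<le> a} x) * iexp (z \<bullet> x))"
proof -
  note [measurable] = F(1)
  let ?I = "indicator {x. w \<bullet> x \<le> a} :: 'a \<Rightarrow> real"
  interpret M: finite_measure M by fact
  interpret N: finite_measure N by fact
  note [measurable_cong] = M(2) N(2)
  have intM: "integrable M (\<lambda>x. of_real (F x) * iexp (y \<bullet> x))"
    and intN: "integrable N (\<lambda>x. of_real (F x) * iexp (y \<bullet> x))" for y
    using F by (auto intro!: M.integrable_const_bound[where B=1] N.integrable_const_bound[where B=1] simp: norm_mult)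
  have intM': "integrable M (\<lambda>x. F x * ?I x * cos (z \<bullet> x))" "integrable M (\<lambda>x. F x * ?I x * sin (z \<bullet> x))" "integrable M (\<lambda>x. F x * ?I x)"
    using F by (auto intro!: M.integrable_const_bound[where B=1] simp: abs_mult split: split_indicator intro!: AE_I2 mult_le_one)
  have intN': "integrable N (\<lambda>x. F x * ?I x * cos (z \<bullet> x))" "integrable N (\<lambda>x. F x * ?I x * sin (z \<bullet> x))" "integrable N (\<lambda>x. F x * ?I x)"
    using F by (auto intro!: N.integrable_const_bound[where B=1] simp: abs_mult split: split_indicator intro!: AE_I2 mult_le_one)
  have comb: "(CLINT x|M. of_real (F x) * iexp (y1 \<bullet> x) + c * (of_real (F x) * iexp (y2 \<bullet> x)) + d * (of_real (F x) * iexp (y3 \<bullet> x)))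
     = (CLINT x|N. of_real (F x) * iexp (y1 \<bullet> x) + c * (of_real (F x) * iexp (y2 \<bullet> x)) + d * (of_real (F x) * iexp (y3 \<bullet> x)))"
    for y1 y2 y3 :: 'a and c d :: complex
    by (simp only: Bochner_Integration.integral_add integrable_mult_right Bochner_Integration.integrable_add
        integral_mult_right_zero intM intN eq)
  have bd: "0 \<le> F x * (1 + c)" "F x * (1 + c) \<le> 2" if "\<bar>c\<bar> \<le> 1" for c x
    using that F(2,3)[of x] mult_mono[of "F x" 1 "1 + c" 2] by auto
  have 0: "(LINT x|M. F x * ?I x) = (LINT x|N. F x * ?I x)"
    by (rule halfspace_integral_eqI[OF M N F, of w]) (use eq[of "_ *\<^sub>R w"] in simp)
  have 1: "(LINT x|M. F x * (1 + cos (z \<bullet> x)) * ?I x) = (LINT x|N. F x * (1 + cos (z \<bullet> x)) * ?I x)"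
  proof (rule halfspace_integral_eqI[OF M N, where K = 2])
    fix s :: real
    have *: "of_real (F x * (1 + cos (z \<bullet> x))) * iexp (s * (w \<bullet> x)) =
        of_real (F x) * iexp ((s *\<^sub>R w) \<bullet> x) + 1/2 * (of_real (F x) * iexp ((s *\<^sub>R w + z) \<bullet> x))
        + 1/2 * (of_real (F x) * iexp ((s *\<^sub>R w - z) \<bullet> x))" for x
      unfolding inner_add_left inner_diff_left inner_scaleR_left by (rule iexp_mult_cos)
    show "(CLINT x|M. of_real (F x * (1 + cos (z \<bullet> x))) * iexp (s * (w \<bullet> x))) =
        (CLINT x|N. of_real (F x * (1 + cos (z \<bullet> x))) * iexp (s * (w \<bullet> x)))"
      unfolding * by (rule comb)
  qed (auto intro!: bd)
  have 2: "(LINT x|M. F x * (1 + sin (z \<bullet> x)) * ?I x) = (LINT x|N. F x * (1 + sin (z \<bullet> x)) * ?I x)"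
  proof (rule halfspace_integral_eqI[OF M N, where K = 2])
    fix s :: real
    have *: "of_real (F x * (1 + sin (z \<bullet> x))) * iexp (s * (w \<bullet> x)) =
        of_real (F x) * iexp ((s *\<^sub>R w) \<bullet> x) + (-\<i>/2) * (of_real (F x) * iexp ((s *\<^sub>R w + z) \<bullet> x))
        + \<i>/2 * (of_real (F x) * iexp ((s *\<^sub>R w - z) \<bullet> x))" for x
      unfolding inner_add_left inner_diff_left inner_scaleR_left by (rule iexp_mult_sin)
    show "(CLINT x|M. of_real (F x * (1 + sin (z \<bullet> x))) * iexp (s * (w \<bullet> x))) =
        (CLINT x|N. of_real (F x * (1 + sin (z \<bullet> x))) * iexp (s * (w \<bullet> x)))"
      unfolding * by (rule comb)
  qed (auto intro!: bd)
  have cos: "(LINT x|M. F x * ?I x * cos (z \<bullet> x)) = (LINT x|N. F x * ?I x * cos (z \<bullet> x))"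
  proof -
    have *: "F x * (1 + cos (z \<bullet> x)) * ?I x = F x * ?I x + F x * ?I x * cos (z \<bullet> x)" for x
      by (simp add: algebra_simps)
    show ?thesis using 1 0 unfolding * by (simp only: Bochner_Integration.integral_add intM' intN')
  qed
  have sin: "(LINT x|M. F x * ?I x * sin (z \<bullet> x)) = (LINT x|N. F x * ?I x * sin (z \<bullet> x))"
  proof -
    have *: "F x * (1 + sin (z \<bullet> x)) * ?I x = F x * ?I x + F x * ?I x * sin (z \<bullet> x)" for x
      by (simp add: algebra_simps)
    show ?thesis using 2 0 unfolding * by (simp only: Bochner_Integration.integral_add intM' intN')
  qed
  have *: "of_real (F x * ?I x) * iexp (z \<bullet> x) =
      of_real (F x * ?I x * cos (z \<bullet> x)) + \<i> * of_real (F x * ?I x * sin (z \<bullet> x))" for x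
    by (simp add: exp_Euler cos_of_real sin_of_real algebra_simps)
  have **: "integral\<^sup>L M (\<lambda>x. complex_of_real (f x)) = of_real (integral\<^sup>L M f)" for M and f :: "'a \<Rightarrow> real"
    by simp
  show ?thesis
  proof -
    have "(CLINT x|K. of_real (F x * ?I x) * iexp (z \<bullet> x)) =
        of_real (LINT x|K. F x * ?I x * cos (z \<bullet> x)) + \<i> * of_real (LINT x|K. F x * ?I x * sin (z \<bullet> x))"
      if "integrable K (\<lambda>x. F x * ?I x * cos (z \<bullet> x))" "integrable K (\<lambda>x. F x * ?I x * sin (z \<bullet> x))" for K
    proof -
      have "(CLINT x|K. of_real (F x * ?I x) * iexp (z \<bullet> x)) = (CLINT x|K. of_real (F x * ?I x * cos (z \<bullet> x)))
          + (CLINT x|K. \<i> * of_real (F x * ?I x * sin (z \<bullet> x)))"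
        unfolding * using that by (intro Bochner_Integration.integral_add integrable_mult_right integrable_of_real)
      then show ?thesis by (simp only: ** integral_mult_right_zero)
    qed
    from this[OF intM'(1,2)] this[OF intN'(1,2)] show ?thesis by (simp only: cos sin)
  qed
qed

text \<open>
  Cutting with one coordinate half-space after the other reaches the corners \<open>{..a}\<close>, which form an
  \<open>\<inter>\<close>-stable generator of the Borel sets.
\<close>

lemma finite_measure_eqI_char_fun:
  fixes M N :: "'a::ordered_euclidean_space measure"
  assumes M: "finite_measure M" "sets M = sets borel"
    and N: "finite_measure N" "sets N = sets borel"
    and eq: "\<And>z. char_fun M z = char_fun N z"
  shows "M = N"
proof -
  interpret M: finite_measure M by fact
  interpret N: finite_measure N by fact
  have sp: "space M = UNIV" "space N = UNIV"
    using sets_eq_imp_space_eq[OF M(2)] sets_eq_imp_space_eq[OF N(2)] by auto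
  have corner: "(CLINT x|M. of_real (indicator {x. \<forall>i\<in>B. i \<bullet> x \<le> i \<bullet> a} x) * iexp (z \<bullet> x)) =
      (CLINT x|N. of_real (indicator {x. \<forall>i\<in>B. i \<bullet> x \<le> i \<bullet> a} x) * iexp (z \<bullet> x))"
    if "finite B" for B :: "'a set" and a z
    using that
  proof (induction B arbitrary: z)
    case empty
    show ?case using eq[of z] by (simp add: char_fun_def)
  next
    case (insert w B)
    have *: "indicator {x. \<forall>i\<in>insert w B. i \<bullet> x \<le> i \<bullet> a} x =
        (indicator {x. \<forall>i\<in>B. i \<bullet> x \<le> i \<bullet> a} x * indicator {x. w \<bullet> x \<le> w \<bullet> a} x :: real)" for x
      by (auto split: split_indicator)
    have [measurable]: "finite B" by fact
    show ?case unfolding *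
      by (rule halfspace_fourier_eqI[OF M N _ _ _ insert.IH])
        (auto simp: indicator_le_1)
  qed
  have atMost: "{..a} = {x. \<forall>i\<in>Basis. i \<bullet> x \<le> i \<bullet> a}" for a :: 'a
    by (auto simp: eucl_le[where 'a='a] inner_commute)
  have "emeasure M {..a} = emeasure N {..a}" for a
  proof -
    have "complex_of_real (measure M {..a}) = of_real (measure N {..a})"
      using corner[of Basis a 0] by (simp add: atMost[symmetric] M N sp)
    then show ?thesis by (simp add: M.emeasure_eq_measure N.emeasure_eq_measure)
  qed
  show ?thesis
  proof (rule measure_eqI_generator_eq[where E = "range (\<lambda>a::'a. {..a})" and \<Omega> = UNIV and A = "\<lambda>n. {..real n *\<^sub>R One}"])
    show "Int_stable (range (\<lambda>a::'a. {..a}))"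
    proof (rule Int_stableI, safe)
      fix a b :: 'a
      have "{..a} \<inter> {..b} = {..inf a b}"
        by auto
      then show "{..a} \<inter> {..b} \<in> range (\<lambda>a. {..a})" by auto
    qed
    show "sets M = sigma_sets UNIV (range (\<lambda>a. {..a}))" "sets N = sigma_sets UNIV (range (\<lambda>a. {..a}))"
      using M(2) N(2) by (auto simp: borel_eq_atMost)
    show "(\<Union>i. {..real i *\<^sub>R One}) = (UNIV :: 'a set)"
    proof safe
      fix x :: 'a
      obtain n :: nat where "norm x \<le> n" using real_arch_simple by blast
      then have "x \<bullet> i \<le> n" if "i \<in> Basis" for i
        using Basis_le_norm[OF that, of x] by linarith
      then have "x \<le> real n *\<^sub>R One" by (auto simp: eucl_le[where 'a='a])
      then show "x \<in> (\<Union>i. {..real i *\<^sub>R One})" by auto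
    qed auto
  qed (auto simp: \<open>\<And>a. emeasure M {..a} = emeasure N {..a}\<close>)
qed

section \<open>Convolutions and compound Poisson laws\<close>

lemma integrable_iexp_inner:
  fixes M :: "'a::euclidean_space measure"
  assumes "finite_measure M" and [measurable_cong]: "sets M = sets borel"
  shows "integrable M (\<lambda>x. iexp (z \<bullet> x))"
proof -
  interpret finite_measure M by fact
  show ?thesis by (intro integrable_const_bound[where B=1]) auto
qed

lemma Re_Im_char_fun:
  fixes M :: "'a::euclidean_space measure"
  assumes "finite_measure M" "sets M = sets borel"
  shows "Re (char_fun M z) = (LINT x|M. cos (z \<bullet> x))" "Im (char_fun M z) = (LINT x|M. sin (z \<bullet> x))"
  unfolding char_fun_def integral_Re[OF integrable_iexp_inner[OF assms], symmetric]
    integral_Im[OF integrable_iexp_inner[OF assms], symmetric]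
  by (simp_all add: Re_exp Im_exp)

lemma char_fun_convolution:
  fixes M N :: "'a::ordered_euclidean_space measure"
  assumes "prob_space M" and [measurable_cong]: "sets M = sets borel"
    and "prob_space N" and [measurable_cong]: "sets N = sets borel"
  shows "char_fun (M \<star> N) z = char_fun M z * char_fun N z"
proof -
  interpret M: prob_space M by fact
  interpret N: prob_space N by fact
  interpret pair_prob_space M N ..
  have int: "integrable (M \<Otimes>\<^sub>M N) (\<lambda>(x, y). iexp (z \<bullet> (x + y)))"
    by (intro integrable_const_bound[where B=1]) (auto simp: split_beta)
  have "char_fun (M \<star> N) z = (CLINT p|M \<Otimes>\<^sub>M N. (\<lambda>(x, y). iexp (z \<bullet> (x + y))) p)"
    by (simp add: char_fun_def convolution_def integral_distr split_beta)
  also have "\<dots> = (CLINT x|M. CLINT y|N. iexp (z \<bullet> x) * iexp (z \<bullet> y))"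
    using integral_fst'[OF int] by (simp add: inner_add_right exp_add algebra_simps)
  finally show ?thesis by (simp add: char_fun_def)
qed

lemma prob_space_convolution:
  assumes "prob_space M" and [measurable_cong]: "sets M = sets borel"
    and "prob_space N" and [measurable_cong]: "sets N = sets borel"
  shows "prob_space (M \<star> N)"
proof -
  interpret M: prob_space M by fact
  interpret N: prob_space N by fact
  interpret pair_prob_space M N ..
  show ?thesis unfolding convolution_def by (intro prob_space_distr) simp
qed

lemma char_fun_convolution_power:
  fixes Q :: "'a::ordered_euclidean_space measure"
  assumes Q: "prob_space Q" "sets Q = sets borel"
  shows "prob_space (((\<star>) Q ^^ n) (return borel 0))"
    and "sets (((\<star>) Q ^^ n) (return borel 0)) = sets borel"
    and "char_fun (((\<star>) Q ^^ n) (return borel 0)) z = char_fun Q z ^ n"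
proof (induction n)
  case 0
  { case 1 show ?case by (auto intro!: prob_space_return) }
  { case 2 show ?case by simp }
  { case 3 show ?case by (simp add: char_fun_def integral_return) }
next
  case (Suc n)
  { case 1 show ?case using Suc Q by (auto intro!: prob_space_convolution) }
  { case 2 show ?case by simp }
  { case 3 show ?case using Suc Q by (simp add: char_fun_convolution) }
qed

text \<open>
  The compound Poisson law with jump law \<open>Q\<close> and rate \<open>r\<close> is the mixture of the convolution powers
  of \<open>Q\<close> with Poisson weights, so its characteristic function is an exponential series. The mixture
  gives mass \<open>exp (- r)\<close> to the empty sum, which is the point mass at \<open>0\<close>; this atom is the origin
  of the constant in the density bound.
\<close>

lemma compound_Poisson_exists:
  fixes Q :: "'a::ordered_euclidean_space measure"
  assumes Q: "prob_space Q" "sets Q = sets borel" and r: "0 < r"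
  shows "\<exists>R. prob_space R \<and> sets R = sets borel \<and> (\<forall>z. char_fun R z = exp (r * (char_fun Q z - 1)))
    \<and> ennreal (exp (- r)) \<le> emeasure R {0}"
proof -
  define K where "K n = ((\<star>) Q ^^ n) (return borel 0)" for n
  define p where "p = poisson_pmf r"
  have K: "prob_space (K n)" "sets (K n) = sets borel" "char_fun (K n) z = char_fun Q z ^ n" for n z
    using char_fun_convolution_power[OF Q] by (auto simp: K_def)
  define R where "R = measure_pmf p \<bind> K"
  have meas: "K \<in> measurable (measure_pmf p) (subprob_algebra borel)"
    using K by (auto simp: space_subprob_algebra intro: prob_space_imp_subprob_space)
  have prob: "prob_space R"
    unfolding R_def using K by (intro measure_pmf.prob_space_bind[OF _ meas]) auto
  have sets: "sets R = sets borel"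
    unfolding R_def using meas by (intro sets_bind[OF _ ]) (auto simp: K)
  have char: "char_fun R z = exp (r * (char_fun Q z - 1))" for z
  proof -
    interpret R: prob_space R by fact
    \<comment> \<open>the mixture formula for real integrands, to be applied to cosine and sine\<close>
    have bind_real: "integral\<^sup>L R f = (LINT n|p. integral\<^sup>L (K n) f)"
      if "f \<in> borel_measurable borel" "\<And>x. \<bar>f x\<bar> \<le> 1" for f :: "'a \<Rightarrow> real"
    proof -
      have "AE n in p. emeasure (K n) (space (K n)) \<le> ennreal 1"
        using prob_space.emeasure_space_1[OF K(1)] by simp
      then show ?thesis
        unfolding R_def using that meas
        by (intro integral_bind[where K=borel and B=1 and B'=1]) (simp_all add: measure_pmf.finite_measure_axioms)
    qed
    have intp: "integrable p (\<lambda>n. char_fun (K n) z)"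
    proof (rule measure_pmf.integrable_const_bound[where B=1])
      have "cmod (char_fun (K n) z) \<le> 1" for n
      proof -
        interpret prob_space "K n" by (rule K)
        have "cmod (char_fun (K n) z) \<le> (LINT x|K n. cmod (iexp (z \<bullet> x)))"
          unfolding char_fun_def by (rule integral_norm_bound)
        then show ?thesis by (simp add: prob_space)
      qed
      then show "AE n in p. cmod (char_fun (K n) z) \<le> 1" by simp
    qed simp
    have "char_fun R z = (CLINT n|p. char_fun (K n) z)"
    proof (rule complex_eqI)
      have "Re (char_fun R z) = (LINT n|p. LINT x|K n. cos (z \<bullet> x))"
        unfolding Re_Im_char_fun[OF R.finite_measure_axioms sets] by (rule bind_real) auto
      also have "\<dots> = (LINT n|p. Re (char_fun (K n) z))"
        using K(1,2) by (simp add: Re_Im_char_fun prob_space.finite_measure)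
      finally show "Re (char_fun R z) = Re (CLINT n|p. char_fun (K n) z)"
        using intp by simp
      have "Im (char_fun R z) = (LINT n|p. LINT x|K n. sin (z \<bullet> x))"
        unfolding Re_Im_char_fun[OF R.finite_measure_axioms sets] by (rule bind_real) auto
      also have "\<dots> = (LINT n|p. Im (char_fun (K n) z))"
        using K(1,2) by (simp add: Re_Im_char_fun prob_space.finite_measure)
      finally show "Im (char_fun R z) = Im (CLINT n|p. char_fun (K n) z)"
        using intp by simp
    qed
    also have "\<dots> = (CLINT n|count_space UNIV. pmf p n *\<^sub>R char_fun Q z ^ n)"
      unfolding measure_pmf_eq_density by (subst integral_density) (auto simp: K)
    also have "\<dots> = exp (r * (char_fun Q z - 1))"
    proof (rule sums_unique2)
      have "integrable (count_space UNIV) (\<lambda>n. pmf p n *\<^sub>R char_fun Q z ^ n)"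
        using intp unfolding measure_pmf_eq_density by (subst (asm) integrable_density) (auto simp: K)
      then show "(\<lambda>n. pmf p n *\<^sub>R char_fun Q z ^ n) sums (CLINT n|count_space UNIV. pmf p n *\<^sub>R char_fun Q z ^ n)"
        by (rule sums_integral_count_space_nat)
      have "(\<lambda>n. exp (- of_real r) * ((r * char_fun Q z) ^ n /\<^sub>R fact n)) sums (exp (- of_real r) * exp (r * char_fun Q z))"
        by (intro sums_mult exp_converges)
      moreover have "exp (- of_real r) * exp (r * char_fun Q z) = exp (r * (char_fun Q z - 1))"
        unfolding exp_add[symmetric] by (simp add: algebra_simps)
      moreover have "exp (- of_real r) * ((r * char_fun Q z) ^ n /\<^sub>R fact n) = pmf p n *\<^sub>R char_fun Q z ^ n" for n
      proof -
        have "exp (- complex_of_real r) = of_real (exp (- r))"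
          using exp_of_real[of "- r"] by simp
        then show ?thesis
          using r by (simp add: p_def scaleR_conv_of_real power_mult_distrib divide_inverse)
      qed
      ultimately show "(\<lambda>n. pmf p n *\<^sub>R char_fun Q z ^ n) sums exp (r * (char_fun Q z - 1))" by simp
    qed
    finally show ?thesis .
  qed
  have "ennreal (exp (- r)) = (\<integral>\<^sup>+n. indicator {0} n \<partial>p)"
    using r by (simp add: emeasure_pmf_single p_def)
  also have "\<dots> \<le> (\<integral>\<^sup>+n. emeasure (K n) {0} \<partial>p)"
    by (intro nn_integral_mono) (auto simp: K_def split: split_indicator)
  also have "\<dots> = emeasure R {0}"
    unfolding R_def by (subst emeasure_bind[OF _ meas]) auto
  finally show ?thesis using prob sets char by blast
qed

text \<open>
  Parametrised by its Levy measure instead of rate and jump law, a compound Poisson law also makes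
  sense for \<open>\<Lambda> = 0\<close>, where no jump law exists and the law is the point mass at \<open>0\<close>.
\<close>

lemma compound_Poisson_finite_measure_exists:
  fixes \<Lambda> :: "'a::ordered_euclidean_space measure"
  assumes \<Lambda>: "finite_measure \<Lambda>" and sets: "sets \<Lambda> = sets borel"
  shows "\<exists>R. prob_space R \<and> sets R = sets borel \<and> (\<forall>z. char_fun R z = exp (CLINT x|\<Lambda>. iexp (z \<bullet> x) - 1))
    \<and> ennreal (exp (- measure \<Lambda> (space \<Lambda>))) \<le> emeasure R {0}"
proof -
  interpret finite_measure \<Lambda> by fact
  note [measurable_cong] = sets
  define r where "r = measure \<Lambda> (space \<Lambda>)"
  show ?thesis
  proof (cases "r = 0")
    case True
    then have "emeasure \<Lambda> (space \<Lambda>) = 0"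
      by (simp add: emeasure_eq_measure r_def)
    then have "AE x in \<Lambda>. False"
      by (intro AE_I[where N="space \<Lambda>"]) auto
    then have "(CLINT x|\<Lambda>. iexp (z \<bullet> x) - 1) = 0" for z
      by (intro integral_eq_zero_AE) auto
    then show ?thesis using True
      by (intro exI[of _ "return borel 0"])
        (auto intro!: prob_space_return simp: char_fun_def integral_return r_def)
  next
    case False
    then have r: "0 < r" by (simp add: r_def less_le)
    define Q where "Q = density \<Lambda> (\<lambda>_. ennreal (1 / r))"
    have Q: "prob_space Q" "sets Q = sets borel"
      using prob_space_normalize False sets by (auto simp: Q_def r_def)
    have "r * (char_fun Q z - 1) = (CLINT x|\<Lambda>. iexp (z \<bullet> x) - 1)" for z
    proof -
      have "char_fun Q z = (CLINT x|\<Lambda>. iexp (z \<bullet> x)) / r"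
        unfolding char_fun_def Q_def using r
        by (subst integral_density) (auto simp: scaleR_conv_of_real)
      moreover have "(CLINT x|\<Lambda>. iexp (z \<bullet> x) - 1) = (CLINT x|\<Lambda>. iexp (z \<bullet> x)) - r"
        by (subst Bochner_Integration.integral_diff)
          (auto intro!: integrable_iexp_inner \<Lambda> sets simp: r_def scaleR_conv_of_real)
      ultimately show ?thesis using r by (simp add: field_simps)
    qed
    then show ?thesis using compound_Poisson_exists[OF Q r] by (simp add: r_def)
  qed
qed

lemma emeasure_convolution_ge_atom:
  fixes M R :: "'a::ordered_euclidean_space measure"
  assumes M: "finite_measure M" "sets M = sets borel"
    and R: "finite_measure R" "sets R = sets borel"
    and B: "B \<in> sets borel"
  shows "emeasure R {0} * emeasure M B \<le> emeasure (M \<star> R) B"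
proof -
  have sp: "space M = UNIV" "space R = UNIV"
    using sets_eq_imp_space_eq[OF M(2)] sets_eq_imp_space_eq[OF R(2)] by auto
  have "emeasure R {0} * emeasure M B = (\<integral>\<^sup>+x. emeasure R {0} * indicator B x \<partial>M)"
    using B M by (simp add: nn_integral_cmult_indicator)
  also have "\<dots> \<le> (\<integral>\<^sup>+x. emeasure R {a. a + x \<in> B} \<partial>M)"
  proof (intro nn_integral_mono)
    fix x
    have "(\<lambda>a. a + x) -` B \<inter> space borel \<in> sets borel"
      by (rule measurable_sets[OF _ B]) simp
    then have "{a. a + x \<in> B} \<in> sets R"
      using R by (simp add: vimage_def)
    then show "emeasure R {0} * indicator B x \<le> emeasure R {a. a + x \<in> B}"
      by (auto intro!: emeasure_mono split: split_indicator)
  qed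
  also have "\<dots> = emeasure (M \<star> R) B"
    using assms sp by (intro convolution_emeasure[symmetric]) auto
  finally show ?thesis .
qed

section \<open>The characteristic function of a Levy process\<close>

text \<open>
  The quotient of two continuous \<open>n\<close>-th roots of the same nonvanishing function is continuous with
  values in the finite set of roots of unity, hence constant. This selects the branch of the root:
  from \<open>p s ^ n = exp (\<psi> s)\<close> at a single \<open>s\<close> nothing more than \<open>p s\<close> up to a root of unity follows.
\<close>

lemma continuous_root_of_exp:
  fixes p \<psi> :: "real \<Rightarrow> complex"
  assumes p: "continuous_on {0..1} p" and \<psi>: "continuous_on {0..1} \<psi>"
    and n: "0 < n" and pow: "\<And>s. s \<in> {0..1} \<Longrightarrow> p s ^ n = exp (\<psi> s)"
    and start: "p 0 = 1" "\<psi> 0 = 0"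
  shows "p 1 = exp (\<psi> 1 / of_nat n)"
proof -
  define r where "r s = p s / exp (\<psi> s / of_nat n)" for s
  have "r ` {0..1} \<subseteq> {w. w ^ n = 1}"
    using n pow by (auto simp: r_def power_divide exp_of_nat_mult[symmetric])
  then have "finite (r ` {0..1})"
    by (rule finite_subset) (use n in \<open>intro finite_roots_unity, auto\<close>)
  moreover have "continuous_on {0..1} r"
    unfolding r_def using n by (intro continuous_intros p \<psi>) auto
  ultimately have "r constant_on {0..1}"
    by (intro continuous_finite_range_constant) auto
  then have "r 1 = r 0" by (auto simp: constant_on_def)
  then show ?thesis by (simp add: r_def start)
qed

lemma norm_iexp_diff_le: "cmod (iexp a - iexp b) \<le> \<bar>a - b\<bar>"
proof -
  have "iexp a - iexp b = iexp b * (iexp (a - b) - 1)"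
    by (simp add: ring_distribs exp_add[symmetric] of_real_diff)
  moreover have "cmod (iexp (a - b) - 1) \<le> \<bar>a - b\<bar>"
    using iexp_approx1[of "a - b" 0] by simp
  ultimately show ?thesis by (simp add: norm_mult)
qed

context levy_process
begin

lemma integrable_iexp_process:
  fixes Y :: "'w \<Rightarrow> 'a"
  assumes [measurable]: "Y \<in> borel_measurable M"
  shows "integrable M (\<lambda>\<omega>. iexp (z \<bullet> Y \<omega>))"
  by (intro integrable_const_bound[where B=1]) auto

text \<open>
  \<open>X 0\<close> vanishes only almost surely, so the increment from \<open>0\<close> to \<open>s\<close> and \<open>X s\<close> agree under the
  integral but not pointwise.
\<close>

lemma char_fun_increment:
  assumes "0 \<le> r" "0 \<le> s"
  shows "(CLINT \<omega>|M. iexp (z \<bullet> (X (r + s) \<omega> - X r \<omega>))) = (CLINT \<omega>|M. iexp (z \<bullet> X s \<omega>))"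
proof -
  have [measurable]: "X r \<in> borel_measurable M" "X s \<in> borel_measurable M"
      "X (r + s) \<in> borel_measurable M" "X 0 \<in> borel_measurable M"
    using assms rv by auto
  have "(CLINT \<omega>|M. iexp (z \<bullet> (X (r + s) \<omega> - X r \<omega>)))
      = (CLINT x|distr M borel (\<lambda>\<omega>. X (r + s) \<omega> - X r \<omega>). iexp (z \<bullet> x))"
    by (simp add: integral_distr)
  also have "\<dots> = (CLINT x|distr M borel (\<lambda>\<omega>. X s \<omega> - X 0 \<omega>). iexp (z \<bullet> x))"
    using stationary_increments[of r s] assms by simp
  also have "\<dots> = (CLINT \<omega>|M. iexp (z \<bullet> (X s \<omega> - X 0 \<omega>)))"
    by (simp add: integral_distr)
  also have "\<dots> = (CLINT \<omega>|M. iexp (z \<bullet> X s \<omega>))"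
    using start by (intro integral_cong_AE) auto
  finally show ?thesis .
qed

lemma char_fun_process_multiple:
  assumes s: "0 < s"
  shows "(CLINT \<omega>|M. iexp (z \<bullet> X (real n * s) \<omega>)) = (CLINT \<omega>|M. iexp (z \<bullet> X s \<omega>)) ^ n"
proof -
  define D where "D i \<omega> = z \<bullet> (X (real (Suc i) * s) \<omega> - X (real i * s) \<omega>)" for i \<omega>
  have rv': "X (real i * s) \<in> borel_measurable M" for i using rv s by simp
  have meas: "D i \<in> borel_measurable M" for i
    unfolding D_def using rv'[of i] rv'[of "Suc i"] by measurable
  have "indep_vars (\<lambda>_. borel) (\<lambda>i \<omega>. X (real (Suc i) * s) \<omega> - X (real i * s) \<omega>) {..<n}"
    using s by (intro indep_increments[where \<tau> = "\<lambda>i. real i * s"]) auto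
  then have "indep_vars (\<lambda>_. borel) D {..<n}"
    unfolding D_def by (rule indep_vars_compose2[where Y = "\<lambda>_ x. z \<bullet> x"]) simp
  then have "char (distr M borel (\<lambda>\<omega>. \<Sum>i<n. D i \<omega>)) 1 = (\<Prod>i<n. char (distr M borel (D i)) 1)"
    by (rule char_distr_sum)
  moreover have "(\<Sum>i<n. D i \<omega>) = z \<bullet> (X (0 + real n * s) \<omega> - X 0 \<omega>)" for \<omega>
    using sum_lessThan_telescope[of "\<lambda>i. z \<bullet> X (real i * s) \<omega>" n]
    by (simp only: D_def inner_diff_right) simp
  moreover have "char (distr M borel (D i)) 1 = (CLINT \<omega>|M. iexp (z \<bullet> X s \<omega>))" for i
  proof -
    have "char (distr M borel (D i)) 1 = (CLINT \<omega>|M. iexp (D i \<omega>))"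
      using meas[of i] by (simp add: char_def integral_distr)
    also have "\<dots> = (CLINT \<omega>|M. iexp (z \<bullet> (X (real i * s + s) \<omega> - X (real i * s) \<omega>)))"
      by (simp add: D_def algebra_simps)
    finally show ?thesis
      using char_fun_increment[of "real i * s" s z] s by simp
  qed
  moreover have "char (distr M borel (\<lambda>\<omega>. \<Sum>i<n. D i \<omega>)) 1 = (CLINT \<omega>|M. iexp (\<Sum>i<n. D i \<omega>))"
    using meas by (simp add: char_def integral_distr)
  ultimately show ?thesis
    using char_fun_increment[of 0 "real n * s" z] s by simp
qed

text \<open>
  Where \<open>X s\<close> and \<open>X t\<close> are close, the exponentials differ by at most \<open>norm z * \<epsilon>\<close>; elsewhere they
  differ by at most \<open>2\<close>, on an event that is small by stochastic continuity.
\<close>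

lemma continuous_char_fun_process:
  "continuous_on {0..} (\<lambda>t. CLINT \<omega>|M. iexp (z \<bullet> X t \<omega>))"
  unfolding continuous_on_def
proof (intro ballI tendstoI)
  fix t e :: real assume "t \<in> {0..}" and e: "0 < e"
  then have t: "0 \<le> t" by simp
  define \<epsilon> where "\<epsilon> = e / (2 * (norm z + 1))"
  have \<epsilon>: "0 < \<epsilon>" "norm z * \<epsilon> < e / 2"
  proof -
    have pos: "0 < norm z + 1" by (simp add: add_nonneg_pos)
    then show "0 < \<epsilon>" using e by (simp add: \<epsilon>_def)
    have "norm z * \<epsilon> = e / 2 * (norm z / (norm z + 1))" by (simp add: \<epsilon>_def)
    also have "\<dots> < e / 2 * 1" using e pos by (intro mult_strict_left_mono) auto
    finally show "norm z * \<epsilon> < e / 2" by simp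
  qed
  have "\<forall>\<^sub>F s in at t within {0..}. dist (prob {\<omega> \<in> space M. norm (X s \<omega> - X t \<omega>) > \<epsilon>}) 0 < e / 4"
    using e by (intro tendstoD[OF stoch_continuous[OF t \<epsilon>(1)]]) simp
  then show "\<forall>\<^sub>F s in at t within {0..}. dist (CLINT \<omega>|M. iexp (z \<bullet> X s \<omega>)) (CLINT \<omega>|M. iexp (z \<bullet> X t \<omega>)) < e"
    unfolding eventually_at_filter
  proof eventually_elim
    case (elim s)
    show ?case
    proof (intro impI)
      assume "s \<noteq> t" "s \<in> {0..}"
      let ?B = "{\<omega> \<in> space M. norm (X s \<omega> - X t \<omega>) > \<epsilon>}"
      have small: "prob ?B < e / 4" using elim \<open>s \<noteq> t\<close> \<open>s \<in> {0..}\<close> by simp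
      have [measurable]: "X s \<in> borel_measurable M" "X t \<in> borel_measurable M"
        using rv t \<open>s \<in> {0..}\<close> by auto
      have pt: "cmod (iexp (z \<bullet> X s \<omega>) - iexp (z \<bullet> X t \<omega>)) \<le> norm z * \<epsilon> + 2 * indicator ?B \<omega>"
        if "\<omega> \<in> space M" for \<omega>
      proof (cases "\<omega> \<in> ?B")
        case True
        have "cmod (iexp (z \<bullet> X s \<omega>) - iexp (z \<bullet> X t \<omega>)) \<le> 2"
          by (rule norm_triangle_le_diff) simp
        then show ?thesis using True \<epsilon>(1) by (simp add: add_increasing)
      next
        case False
        have "cmod (iexp (z \<bullet> X s \<omega>) - iexp (z \<bullet> X t \<omega>)) \<le> \<bar>z \<bullet> (X s \<omega> - X t \<omega>)\<bar>"
          using norm_iexp_diff_le by (simp add: inner_diff_right)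
        also have "\<dots> \<le> norm z * norm (X s \<omega> - X t \<omega>)" by (rule Cauchy_Schwarz_ineq2)
        also have "\<dots> \<le> norm z * \<epsilon>" using False that by (intro mult_left_mono) auto
        finally show ?thesis using False by simp
      qed
      have "dist (CLINT \<omega>|M. iexp (z \<bullet> X s \<omega>)) (CLINT \<omega>|M. iexp (z \<bullet> X t \<omega>))
          = cmod (CLINT \<omega>|M. iexp (z \<bullet> X s \<omega>) - iexp (z \<bullet> X t \<omega>))"
        by (simp add: dist_norm integrable_iexp_process)
      also have "\<dots> \<le> (LINT \<omega>|M. cmod (iexp (z \<bullet> X s \<omega>) - iexp (z \<bullet> X t \<omega>)))"
        by (rule integral_norm_bound)
      also have "\<dots> \<le> (LINT \<omega>|M. norm z * \<epsilon> + 2 * indicator ?B \<omega>)"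
        by (intro integral_mono integrable_norm Bochner_Integration.integrable_diff integrable_iexp_process pt
            Bochner_Integration.integrable_add integrable_mult_right integrable_real_indicator) (auto simp: emeasure_eq_measure)
      also have "\<dots> = norm z * \<epsilon> + 2 * prob ?B"
        by (subst Bochner_Integration.integral_add) (auto simp: prob_space emeasure_eq_measure)
      also have "\<dots> < e" using \<epsilon>(2) small by linarith
      finally show "dist (CLINT \<omega>|M. iexp (z \<bullet> X s \<omega>)) (CLINT \<omega>|M. iexp (z \<bullet> X t \<omega>)) < e" .
    qed
  qed
qed

text \<open>
  Independent stationary increments give \<open>E (iexp (z \<bullet> X (1 / n))) ^ n = exp (\<Psi> z)\<close>. To extract the
  root, \<open>z\<close> is moved along the segment from \<open>0\<close>, where both sides are \<open>1\<close>. Multiples of \<open>1 / n\<close> and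
  continuity in time then lead to rational and to all real times.
\<close>

lemma char_fun_process_eq_exp:
  assumes cont: "\<And>z. continuous_on {0..1} (\<lambda>s. \<Psi> (s *\<^sub>R z))" and zero: "\<Psi> 0 = 0"
    and one: "\<And>z. (CLINT \<omega>|M. iexp (z \<bullet> X 1 \<omega>)) = exp (\<Psi> z)"
    and t: "0 \<le> t"
  shows "(CLINT \<omega>|M. iexp (z \<bullet> X t \<omega>)) = exp (of_real t * \<Psi> z)"
proof -
  define c where "c t z = (CLINT \<omega>|M. iexp (z \<bullet> X t \<omega>))" for t z
  have unit_fraction: "c (1 / real n) z = exp (\<Psi> z / of_nat n)" if n: "0 < n" for n z
  proof -
    have [measurable]: "X (1 / real n) \<in> borel_measurable M" by (simp add: rv)
    let ?D = "distr M borel (\<lambda>\<omega>. z \<bullet> X (1 / real n) \<omega>)"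
    interpret D: real_distribution ?D
      by (intro real_distribution.intro prob_space_distr real_distribution_axioms.intro) auto
    have D: "c (1 / real n) (s *\<^sub>R z) = char ?D s" for s
      by (simp add: c_def char_def integral_distr)
    have "c (1 / real n) (1 *\<^sub>R z) = exp (\<Psi> (1 *\<^sub>R z) / of_nat n)"
    proof (rule continuous_root_of_exp[where p = "\<lambda>s. c (1 / real n) (s *\<^sub>R z)" and \<psi> = "\<lambda>s. \<Psi> (s *\<^sub>R z)"])
      show "continuous_on {0..1} (\<lambda>s. c (1 / real n) (s *\<^sub>R z))"
        unfolding D by (intro continuous_at_imp_continuous_on ballI D.isCont_char)
      show "c (1 / real n) (s *\<^sub>R z) ^ n = exp (\<Psi> (s *\<^sub>R z))" for s
        using char_fun_process_multiple[of "1 / real n" "s *\<^sub>R z" n] n one[of "s *\<^sub>R z"]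
        by (simp add: c_def)
      show "c (1 / real n) (0 *\<^sub>R z) = 1" by (simp add: c_def prob_space)
    qed (use n cont zero in auto)
    then show ?thesis by simp
  qed
  have fraction: "c (real m / real n) z = exp (of_real (real m / real n) * \<Psi> z)" if "0 < n" for m n
    using char_fun_process_multiple[of "1 / real n" z m] unit_fraction[OF that, of z] that
    by (simp add: c_def exp_of_nat_mult[symmetric])
  \<comment> \<open>rational times from below that converge to \<open>t\<close>\<close>
  define q where "q k = real (nat \<lfloor>t * real (Suc k)\<rfloor>) / real (Suc k)" for k
  have q: "q \<longlonglongrightarrow> t"
  proof (rule real_tendsto_sandwich)
    have fl: "real (nat \<lfloor>t * real (Suc k)\<rfloor>) = of_int \<lfloor>t * real (Suc k)\<rfloor>" for k
      using t by simp
    show "\<forall>\<^sub>F k in sequentially. t - 1 / real (Suc k) \<le> q k"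
    proof (intro always_eventually allI)
      fix k
      have "t * real (Suc k) - 1 \<le> of_int \<lfloor>t * real (Suc k)\<rfloor>" by linarith
      then have "(t * real (Suc k) - 1) / real (Suc k) \<le> q k"
        unfolding q_def fl by (intro divide_right_mono) auto
      then show "t - 1 / real (Suc k) \<le> q k" by (simp add: diff_divide_distrib del: of_nat_Suc)
    qed
    show "\<forall>\<^sub>F k in sequentially. q k \<le> t"
      unfolding q_def fl by (intro always_eventually allI) (simp add: divide_le_eq del: of_nat_Suc)
    show "(\<lambda>k. t - 1 / real (Suc k)) \<longlonglongrightarrow> t"
      using tendsto_diff[OF tendsto_const[of t] LIMSEQ_inverse_real_of_nat] by (simp add: inverse_eq_divide)
  qed simp
  have "(\<lambda>k. c (q k) z) \<longlonglongrightarrow> c t z"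
    unfolding c_def using t
    by (intro continuous_on_tendsto_compose[OF continuous_char_fun_process q]) (auto simp: q_def)
  moreover have "(\<lambda>k. c (q k) z) \<longlonglongrightarrow> exp (of_real t * \<Psi> z)"
    unfolding q_def fraction[OF zero_less_Suc] unfolding q_def[symmetric]
    by (intro tendsto_intros q)
  ultimately show ?thesis unfolding c_def by (rule LIMSEQ_unique)
qed

end

text \<open>
  For the truncation function \<open>h\<close> only integrability of the integrand at each fixed \<open>z\<close> is
  known, so the integrand at \<open>s z\<close> has to be compared with the one at \<open>z\<close>. In the difference
  of the integrand at \<open>s z\<close> and \<open>s\<close> times the integrand at \<open>z\<close> the truncation term cancels, and
  with \<open>u = z \<bullet> x\<close> what remains is bounded here by a function that every Levy measure integrates.
\<close>

lemma norm_iexp_interpolation_le: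
  assumes s: "0 \<le> s" "s \<le> 1"
  shows "cmod (iexp (s * u) - 1 - s * (iexp u - 1)) \<le> 4 * min (u\<^sup>2) 1"
proof -
  have 1: "cmod (iexp x - (1 + \<i> * x)) \<le> x\<^sup>2 / 2" for x :: real
    using iexp_approx1[of x 1] by (simp add: numeral_2_eq_2)
  have "cmod (iexp (s * u) - 1 - s * (iexp u - 1)) = cmod ((iexp (s * u) - (1 + \<i> * (s * u))) - s * (iexp u - (1 + \<i> * u)))"
    by (simp add: algebra_simps)
  also have "\<dots> \<le> (s * u)\<^sup>2 / 2 + s * (u\<^sup>2 / 2)"
    using 1[of "s * u"] mult_left_mono[OF 1[of u] s(1)] s by (intro norm_triangle_le_diff) (simp add: norm_mult)
  also have "\<dots> \<le> u\<^sup>2 / 2 + u\<^sup>2 / 2"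
    using s mult_right_mono[of "s\<^sup>2" 1 "u\<^sup>2"] mult_right_mono[of s 1 "u\<^sup>2"]
    by (intro add_mono) (auto simp: power_mult_distrib power_le_one)
  finally have small: "cmod (iexp (s * u) - 1 - s * (iexp u - 1)) \<le> u\<^sup>2" by simp
  have 2: "cmod (iexp x - 1) \<le> 2" for x :: real by (rule norm_triangle_le_diff) simp
  have "cmod (iexp (s * u) - 1 - s * (iexp u - 1)) \<le> 2 + s * 2"
    using 2[of "s * u"] mult_left_mono[OF 2[of u] s(1)] s by (intro norm_triangle_le_diff) (simp add: norm_mult)
  then have "cmod (iexp (s * u) - 1 - s * (iexp u - 1)) \<le> 4" using s by linarith
  moreover have "cmod (iexp (s * u) - 1 - s * (iexp u - 1)) \<le> 4 * u\<^sup>2"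
    using small zero_le_power2[of u] by linarith
  ultimately show ?thesis unfolding min_def by (simp only: mult_1_right split: if_split) simp
qed

lemma levy_exponent_zero: "levy_exponent A L b h 0 = 0"
  by (simp add: levy_exponent_def levy_integrand_def)

text \<open>
  Continuity along segments from the origin is all that the extraction of roots requires, and on a
  segment the integrand has a dominating function that does not depend on the parameter.
\<close>

lemma continuous_on_levy_exponent_line:
  fixes L :: "(real ^ 'n) measure"
  assumes L: "levy_measure L" and int: "\<And>z. integrable L (levy_integrand h z)"
  shows "continuous_on {0..1} (\<lambda>s. levy_exponent A L b h (s *\<^sub>R z))"
proof -
  have [measurable_cong]: "sets L = sets borel" using L by (simp add: levy_measure_def)
  have "integrable L (\<lambda>x. min ((norm x)\<^sup>2) 1)"
    using L by (intro integrableI_bounded) (auto simp: levy_measure_def)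
  then have *: "integrable L (\<lambda>x. (1 + (norm z)\<^sup>2) * min ((norm x)\<^sup>2) 1)" by simp
  have intmin: "integrable L (\<lambda>x. 4 * min ((z \<bullet> x)\<^sup>2) 1)"
  proof (intro integrable_mult_right Bochner_Integration.integrable_bound[OF *] AE_I2)
    fix x
    have "(z \<bullet> x)\<^sup>2 \<le> (norm z * norm x)\<^sup>2"
      using Cauchy_Schwarz_ineq2[of z x] by (intro abs_le_square_iff[THEN iffD1]) simp
    then have "min ((z \<bullet> x)\<^sup>2) 1 \<le> (1 + (norm z)\<^sup>2) * min ((norm x)\<^sup>2) 1"
      by (simp add: min_def power_mult_distrib algebra_simps) (smt (verit) zero_le_power2)
    then show "norm (min ((z \<bullet> x)\<^sup>2) 1) \<le> norm ((1 + (norm z)\<^sup>2) * min ((norm x)\<^sup>2) 1)" by simp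
  qed simp
  have "continuous_on {0..1} (\<lambda>s. CLINT x|L. levy_integrand h (s *\<^sub>R z) x)"
    unfolding continuous_on_sequentially comp_def
  proof safe
    fix \<sigma> :: "nat \<Rightarrow> real" and s
    assume s: "s \<in> {0..1}" and \<sigma>: "\<forall>n. \<sigma> n \<in> {0..1}" "\<sigma> \<longlonglongrightarrow> s"
    show "(\<lambda>n. CLINT x|L. levy_integrand h (\<sigma> n *\<^sub>R z) x) \<longlonglongrightarrow> (CLINT x|L. levy_integrand h (s *\<^sub>R z) x)"
    proof (rule integral_dominated_convergence[where w = "\<lambda>x. 4 * min ((z \<bullet> x)\<^sup>2) 1 + cmod (levy_integrand h z x)"])
      show "AE x in L. (\<lambda>n. levy_integrand h (\<sigma> n *\<^sub>R z) x) \<longlonglongrightarrow> levy_integrand h (s *\<^sub>R z) x"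
        unfolding levy_integrand_def inner_scaleR_left by (intro AE_I2 tendsto_intros \<sigma>(2))
      show "AE x in L. cmod (levy_integrand h (\<sigma> n *\<^sub>R z) x) \<le> 4 * min ((z \<bullet> x)\<^sup>2) 1 + cmod (levy_integrand h z x)" for n
      proof (intro AE_I2)
        fix x
        have \<sigma>n: "0 \<le> \<sigma> n" "\<sigma> n \<le> 1" using \<sigma>(1) by auto
        have "levy_integrand h (\<sigma> n *\<^sub>R z) x =
            (iexp (\<sigma> n * (z \<bullet> x)) - 1 - \<sigma> n * (iexp (z \<bullet> x) - 1)) + \<sigma> n * levy_integrand h z x"
          by (simp add: levy_integrand_def algebra_simps)
        also have "cmod \<dots> \<le> 4 * min ((z \<bullet> x)\<^sup>2) 1 + cmod (levy_integrand h z x)"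
          using \<sigma>n by (intro norm_triangle_mono norm_iexp_interpolation_le) (auto simp: norm_mult mult_left_le_one_le)
        finally show "cmod (levy_integrand h (\<sigma> n *\<^sub>R z) x) \<le> 4 * min ((z \<bullet> x)\<^sup>2) 1 + cmod (levy_integrand h z x)" .
      qed
    qed (use intmin int in auto)
  qed
  moreover have "(s *\<^sub>R z) \<bullet> (A *v (s *\<^sub>R z)) = s * (s * (z \<bullet> (A *v z)))" for s :: real
    by (simp add: matrix_vector_mult_scaleR)
  ultimately show ?thesis
    unfolding levy_exponent_def by (simp only: inner_scaleR_right) (intro continuous_intros, auto)
qed

lemma char_fun_levy_process:
  fixes L :: "(real ^ 'n) measure"
  assumes X: "levy_process M X" and X1: "distr M borel (X 1) = \<mu>" and \<mu>: "ID_law \<mu> A L b h"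
    and t: "0 \<le> t"
  shows "char_fun (distr M borel (X t)) z = exp (of_real t * levy_exponent A L b h z)"
proof -
  interpret levy_process M X by fact
  have eq: "char_fun (distr M borel (X t)) z = (CLINT \<omega>|M. iexp (z \<bullet> X t \<omega>))" if "0 \<le> t" for t z
    using rv[OF that] by (simp add: char_fun_def integral_distr)
  have "(CLINT \<omega>|M. iexp (z \<bullet> X t \<omega>)) = exp (of_real t * levy_exponent A L b h z)"
  proof (rule char_fun_process_eq_exp)
    show "(CLINT \<omega>|M. iexp (z \<bullet> X 1 \<omega>)) = exp (levy_exponent A L b h z)" for z
      using eq[of 1 z] \<mu> X1 by (simp add: ID_law_def)
  qed (use \<mu> t in \<open>auto simp: ID_law_def levy_exponent_zero intro: continuous_on_levy_exponent_line\<close>)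
  then show ?thesis by (simp add: eq t)
qed

section \<open>Thinning the Levy measure\<close>

text \<open>
  The shift of the drift is exactly what removes the truncation function from the difference of the
  two exponents. What is left is the exponent of a compound Poisson law with finite Levy measure
  \<open>(1 - g) L\<close>.
\<close>

lemma levy_exponent_thinning:
  fixes L :: "(real ^ 'n) measure"
  assumes L: "sets L = sets borel"
    and int: "integrable L (levy_integrand h z)"
    and g [measurable]: "g \<in> borel_measurable borel" and g01: "\<And>x. 0 \<le> g x" "\<And>x. g x \<le> 1"
    and int1: "integrable L (\<lambda>x. 1 - g x)" and int2: "integrable L (\<lambda>x. (h x * (1 - g x)) *\<^sub>R x)"
  shows "levy_exponent A L b h z =
    levy_exponent A (density L (\<lambda>x. ennreal (g x))) (b - (LINT x|L. (h x * (1 - g x)) *\<^sub>R x)) h z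
    + (CLINT x|L. of_real (1 - g x) * (iexp (z \<bullet> x) - 1))"
proof -
  note [measurable_cong] = L
  let ?k = "levy_integrand h z" and ?v = "LINT x|L. (h x * (1 - g x)) *\<^sub>R x"
  have [measurable]: "?k \<in> borel_measurable L" using int by auto
  have intg: "integrable L (\<lambda>x. g x *\<^sub>R ?k x)"
    using int by (rule Bochner_Integration.integrable_bound)
      (auto intro!: AE_I2 mult_left_le_one_le simp: g01)
  have intk: "integrable L (\<lambda>x. (1 - g x) *\<^sub>R ?k x)"
    using Bochner_Integration.integrable_diff[OF int intg] by (simp add: scaleR_left_diff_distrib)
  have intv: "integrable L (\<lambda>x. complex_of_real (((h x * (1 - g x)) *\<^sub>R x) \<bullet> z))"
    using int2 by (intro integrable_of_real integrable_inner_left) auto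
  have "(CLINT x|L. ?k x) = (CLINT x|L. g x *\<^sub>R ?k x) + (CLINT x|L. (1 - g x) *\<^sub>R ?k x)"
    by (subst Bochner_Integration.integral_add[OF intg intk, symmetric])
      (simp add: scaleR_left_distrib[symmetric])
  moreover have "(CLINT x|density L (\<lambda>x. ennreal (g x)). ?k x) = (CLINT x|L. g x *\<^sub>R ?k x)"
    by (intro integral_density) (auto simp: g01)
  moreover have "(CLINT x|L. of_real (1 - g x) * (iexp (z \<bullet> x) - 1)) =
      (CLINT x|L. (1 - g x) *\<^sub>R ?k x) + \<i> * of_real (?v \<bullet> z)"
  proof -
    have "?v \<bullet> z = (LINT x|L. ((h x * (1 - g x)) *\<^sub>R x) \<bullet> z)"
      by (rule integral_inner_left[symmetric]) (rule int2)
    then have "\<i> * of_real (?v \<bullet> z) = (CLINT x|L. \<i> * of_real (((h x * (1 - g x)) *\<^sub>R x) \<bullet> z))"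
      by (simp only: integral_mult_right_zero integral_complex_of_real)
    moreover have "of_real (1 - g x) * (iexp (z \<bullet> x) - 1) =
        (1 - g x) *\<^sub>R ?k x + \<i> * of_real (((h x * (1 - g x)) *\<^sub>R x) \<bullet> z)" for x
      unfolding inner_scaleR_left levy_integrand_def
      by (simp add: scaleR_conv_of_real inner_commute[of x z] algebra_simps)
    ultimately show ?thesis
      using intk intv by (simp only: Bochner_Integration.integral_add integrable_mult_right)
  qed
  ultimately show ?thesis
    unfolding levy_exponent_def by (simp add: inner_diff_left algebra_simps)
qed

text \<open>
  By uniqueness of characteristic functions, the law of \<open>X t\<close> is the convolution of the law of
  \<open>Xt t\<close> with a compound Poisson law \<open>R\<close>. Restricting the convolution to the event that the
  compound Poisson part vanishes, which has probability at least \<open>exp (- t \<eta>)\<close>, gives the bound.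
\<close>

lemma levy_thinning_domination:
  fixes L :: "(real ^ 'n) measure" and X :: "real \<Rightarrow> 'w \<Rightarrow> real ^ 'n" and Xt :: "real \<Rightarrow> 'v \<Rightarrow> real ^ 'n"
  assumes \<mu>: "ID_law \<mu> A L b h"
    and g [measurable]: "g \<in> borel_measurable borel" and g01: "\<And>x. 0 \<le> g x" "\<And>x. g x \<le> 1"
    and A2: "(\<integral>\<^sup>+ x. ennreal (max (norm (h x *\<^sub>R x)) 1 * (1 - g x)) \<partial>L) < \<infinity>"
    and \<mu>t: "ID_law \<mu>t A (density L (\<lambda>x. ennreal (g x))) (b - (LINT x|L. (h x * (1 - g x)) *\<^sub>R x)) h"
    and X: "levy_process M X" and X1: "distr M borel (X 1) = \<mu>"
    and Xt: "levy_process Mt Xt" and Xt1: "distr Mt borel (Xt 1) = \<mu>t"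
    and t: "0 \<le> t" and B: "B \<in> sets borel"
  shows "ennreal (exp (- (t * (LINT x|L. 1 - g x)))) * emeasure (distr Mt borel (Xt t)) B
    \<le> emeasure (distr M borel (X t)) B"
proof -
  have L [measurable_cong]: "sets L = sets borel" and h [measurable]: "h \<in> borel_measurable borel"
    and int: "integrable L (levy_integrand h z)" for z
    using \<mu> by (auto simp: ID_law_def levy_measure_def)
  have intmax: "integrable L (\<lambda>x. max (norm (h x *\<^sub>R x)) 1 * (1 - g x))"
    using A2 g01 by (intro integrableI_bounded) (auto simp: abs_mult)
  have int1: "integrable L (\<lambda>x. 1 - g x)"
  proof (rule Bochner_Integration.integrable_bound[OF intmax], simp, intro AE_I2)
    fix x
    show "norm (1 - g x) \<le> norm (max (norm (h x *\<^sub>R x)) 1 * (1 - g x))"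
      using g01[of x] mult_right_mono[of 1 "max (norm (h x *\<^sub>R x)) 1" "1 - g x"] by (simp add: abs_mult)
  qed
  have int2: "integrable L (\<lambda>x. (h x * (1 - g x)) *\<^sub>R x)"
  proof (rule Bochner_Integration.integrable_bound[OF intmax], simp, intro AE_I2)
    fix x
    show "norm ((h x * (1 - g x)) *\<^sub>R x) \<le> norm (max (norm (h x *\<^sub>R x)) 1 * (1 - g x))"
      using g01[of x] mult_right_mono[of "norm (h x *\<^sub>R x)" "max (norm (h x *\<^sub>R x)) 1" "1 - g x"]
      by (simp add: abs_mult mult_ac)
  qed
  \<comment> \<open>Levy measure, at time \<open>t\<close>, of the jumps that thinning removes\<close>
  define \<Lambda> where "\<Lambda> = density L (\<lambda>x. ennreal (t * (1 - g x)))"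
  have mass: "emeasure \<Lambda> (space \<Lambda>) = ennreal (t * (LINT x|L. 1 - g x))"
  proof -
    have "emeasure \<Lambda> (space \<Lambda>) = (\<integral>\<^sup>+x. ennreal (t * (1 - g x)) \<partial>L)"
      unfolding \<Lambda>_def by (auto simp: emeasure_density intro!: nn_integral_cong)
    also have "\<dots> = ennreal (LINT x|L. t * (1 - g x))"
      using int1 g01 t by (intro nn_integral_eq_integral) auto
    finally show ?thesis by simp
  qed
  have nonneg: "0 \<le> t * (LINT x|L. 1 - g x)"
    using t g01 by (intro mult_nonneg_nonneg integral_nonneg_AE) auto
  have fin: "finite_measure \<Lambda>" by (rule finite_measureI) (simp add: mass)
  have sets: "sets \<Lambda> = sets borel" by (simp add: \<Lambda>_def L)
  from compound_Poisson_finite_measure_exists[OF fin sets] obtain R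
    where R: "prob_space R" "sets R = sets borel"
      and R_char: "\<And>z. char_fun R z = exp (CLINT x|\<Lambda>. iexp (z \<bullet> x) - 1)"
      and R_atom: "ennreal (exp (- measure \<Lambda> (space \<Lambda>))) \<le> emeasure R {0}"
    by blast
  interpret X: levy_process M X by fact
  interpret Xt: levy_process Mt Xt by fact
  let ?N = "distr M borel (X t)" and ?Nt = "distr Mt borel (Xt t)"
  have N: "prob_space ?N" and Nt: "prob_space ?Nt"
    using X.rv[OF t] Xt.rv[OF t] by (auto intro: X.prob_space_distr Xt.prob_space_distr)
  have "?N = (?Nt \<star> R)"
  proof (rule finite_measure_eqI_char_fun)
    fix z
    have "(CLINT x|\<Lambda>. iexp (z \<bullet> x) - 1) = (CLINT x|L. of_real t * (of_real (1 - g x) * (iexp (z \<bullet> x) - 1)))"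
      unfolding \<Lambda>_def using t g01
      by (subst integral_density) (auto simp: scaleR_conv_of_real mult.assoc)
    also have "\<dots> = of_real t * (CLINT x|L. of_real (1 - g x) * (iexp (z \<bullet> x) - 1))"
      by (rule integral_mult_right_zero)
    finally show "char_fun ?N z = char_fun (?Nt \<star> R) z"
      unfolding char_fun_levy_process[OF X X1 \<mu> t] levy_exponent_thinning[OF L int g g01 int1 int2]
      by (subst char_fun_convolution)
        (auto simp: Nt R R_char char_fun_levy_process[OF Xt Xt1 \<mu>t t] exp_add[symmetric] ring_distribs)
  qed (auto simp: N Nt R prob_space.finite_measure intro!: convolution_finite)
  moreover
  have "ennreal (exp (- (t * (LINT x|L. 1 - g x)))) \<le> emeasure R {0}"
    using R_atom mass nonneg by (simp add: measure_def)
  then have "ennreal (exp (- (t * (LINT x|L. 1 - g x)))) * emeasure ?Nt B \<le> emeasure R {0} * emeasure ?Nt B"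
    by (rule mult_right_mono) simp
  moreover have "emeasure R {0} * emeasure ?Nt B \<le> emeasure (?Nt \<star> R) B"
    using Nt R B by (intro emeasure_convolution_ge_atom) (auto simp: prob_space.finite_measure)
  ultimately show ?thesis by simp
qed

text \<open>
  Since \<open>g\<close> has a finite integral, the integrals can be subtracted over the set where the
  inequality fails.
\<close>

lemma AE_le_of_emeasure_density_le:
  assumes [measurable]: "f \<in> borel_measurable M" "g \<in> borel_measurable M"
    and fin: "(\<integral>\<^sup>+x. g x \<partial>M) < \<infinity>"
    and le: "\<And>A. A \<in> sets M \<Longrightarrow> emeasure (density M f) A \<le> emeasure (density M g) A"
  shows "AE x in M. f x \<le> g x"
proof -
  let ?A = "{x \<in> space M. g x < f x}"
  have "(\<integral>\<^sup>+x. g x * indicator ?A x \<partial>M) \<le> (\<integral>\<^sup>+x. g x \<partial>M)"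
    by (intro nn_integral_mono) (auto split: split_indicator)
  then have fin': "(\<integral>\<^sup>+x. g x * indicator ?A x \<partial>M) \<noteq> \<infinity>" using fin by auto
  have "(\<integral>\<^sup>+x. f x * indicator ?A x - g x * indicator ?A x \<partial>M) =
      (\<integral>\<^sup>+x. f x * indicator ?A x \<partial>M) - (\<integral>\<^sup>+x. g x * indicator ?A x \<partial>M)"
    by (intro nn_integral_diff fin') (auto split: split_indicator)
  also have "\<dots> = 0"
    using le[of ?A] fin' le_less_trans[of _ "\<integral>\<^sup>+x. g x * indicator ?A x \<partial>M" \<top>]
    by (simp add: emeasure_density less_top diff_eq_0_ennreal)
  finally have "AE x in M. f x * indicator ?A x - g x * indicator ?A x = 0"
    by (subst (asm) nn_integral_0_iff_AE) auto
  then show ?thesis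
    by (rule AE_mp) (auto intro!: AE_I2 simp: diff_eq_0_iff_ennreal not_le split: split_indicator_asm)
qed

section \<open>Rejection sampling\<close>

text \<open>
  Sampling from \<open>ft\<close> with proposals from \<open>f\<close>, under the domination \<open>c * ft \<le> f\<close>. The acceptance probability \<open>c * ft / f\<close> makes the accepted part of the proposal law equal
  to \<open>c\<close> times the target law.
\<close>

locale rejection_sampling = rejection_inputs P U Y f
  for P :: "'p measure" and U :: "nat \<Rightarrow> 'p \<Rightarrow> real"
    and Y :: "nat \<Rightarrow> 'p \<Rightarrow> 'a::euclidean_space" and f :: "'a \<Rightarrow> real" +
  fixes ft :: "'a \<Rightarrow> real" and c :: real
  assumes f_meas [measurable]: "f \<in> borel_measurable borel" and f_nonneg: "\<And>x. 0 \<le> f x"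
    and ft_meas [measurable]: "ft \<in> borel_measurable borel" and ft_nonneg: "\<And>x. 0 \<le> ft x"
    and ft_mass: "(\<integral>\<^sup>+x. ennreal (ft x) \<partial>lborel) = 1"
    and c_pos: "0 < c" and dominated: "AE x in lborel. c * ft x \<le> f x"
begin

definition accept_region :: "'a set \<Rightarrow> (real \<times> 'a) set" where
  "accept_region B = {(u, y). u \<le> c * ft y / f y \<and> y \<in> B}"

abbreviation target :: "'a measure" where
  "target \<equiv> density lborel (\<lambda>x. ennreal (ft x))"

lemma prob_space_target: "prob_space target"
  by (rule prob_spaceI) (simp add: emeasure_density ft_mass)

lemma rv_U [measurable]: "U n \<in> borel_measurable P" and rv_Y [measurable]: "Y n \<in> borel_measurable P"
  using distributed_measurable[OF U_uniform[of n]] distributed_measurable[OF Y_density[of n]] by simp_all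

lemma accept_region_sets [measurable]: "B \<in> sets borel \<Longrightarrow> accept_region B \<in> sets (borel \<Otimes>\<^sub>M borel)"
proof -
  assume [measurable]: "B \<in> sets borel"
  have "accept_region B = {p \<in> space (borel \<Otimes>\<^sub>M borel). fst p \<le> c * ft (snd p) / f (snd p) \<and> snd p \<in> B}"
    by (auto simp: accept_region_def space_pair_measure)
  then show ?thesis by simp
qed

lemma joint_law:
  "distr P (borel \<Otimes>\<^sub>M borel) (\<lambda>\<omega>. (U n \<omega>, Y n \<omega>)) =
    density lborel (indicator {0<..<1}) \<Otimes>\<^sub>M density lborel (\<lambda>x. ennreal (f x))"
proof -
  have U: "density lborel (indicator {0<..<1}) = distr P borel (U n)"
    using distributed_distr_eq_density[OF U_uniform[of n]] by (simp cong: distr_cong)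
  have Y: "density lborel (\<lambda>x. ennreal (f x)) = distr P borel (Y n)"
    using distributed_distr_eq_density[OF Y_density[of n]] by (simp cong: distr_cong)
  have "distr P borel (U n) \<Otimes>\<^sub>M distr P borel (Y n) = distr P (borel \<Otimes>\<^sub>M borel) (\<lambda>\<omega>. (U n \<omega>, Y n \<omega>))"
  proof (rule pair_measure_eqI)
    show "sigma_finite_measure (distr P borel (U n))" "sigma_finite_measure (distr P borel (Y n))"
      by (auto intro!: prob_space_imp_sigma_finite prob_space_distr)
    fix A B assume "A \<in> sets (distr P borel (U n))" "B \<in> sets (distr P borel (Y n))"
    then have [measurable]: "A \<in> sets borel" "B \<in> sets borel" by auto
    have "prob ((U n -` A \<inter> space P) \<inter> (Y n -` B \<inter> space P)) = prob (U n -` A \<inter> space P) * prob (Y n -` B \<inter> space P)"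
      by (rule indep_setD[OF indep_within[of n]]) auto
    moreover have "(\<lambda>\<omega>. (U n \<omega>, Y n \<omega>)) -` (A \<times> B) \<inter> space P = (U n -` A \<inter> space P) \<inter> (Y n -` B \<inter> space P)"
      by auto
    ultimately show "emeasure (distr P borel (U n)) A * emeasure (distr P borel (Y n)) B =
        emeasure (distr P (borel \<Otimes>\<^sub>M borel) (\<lambda>\<omega>. (U n \<omega>, Y n \<omega>))) (A \<times> B)"
      by (simp add: emeasure_distr emeasure_eq_measure ennreal_mult)
  qed (simp cong: sets_pair_measure_cong)
  then show ?thesis by (simp add: U Y)
qed

lemma emeasure_uniform_atMost:
  assumes "0 \<le> a" "a \<le> 1"
  shows "emeasure (density lborel (indicator {0<..<1})) {..a} = ennreal a"
proof -
  have "emeasure (density lborel (indicator {0<..<1})) {..a} = emeasure lborel ({0<..<1} \<inter> {..a})"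
    by (simp add: emeasure_density indicator_inter_arith[symmetric])
  also have "\<dots> = ennreal a"
  proof (cases "a = 1")
    case True
    then have "{0<..<1} \<inter> {..a} = {0<..<1}" by auto
    then show ?thesis using True by simp
  next
    case False
    then have "{0<..<1} \<inter> {..a} = {0<..a}" using assms by auto
    then show ?thesis using assms by simp
  qed
  finally show ?thesis .
qed

text \<open>
  Given \<open>Y n = y\<close>, the conditional probability of acceptance is \<open>c * ft y / f y\<close>, and the factor
  \<open>f y\<close> of the proposal density cancels the denominator. Almost everywhere on \<open>f y = 0\<close> the
  domination forces \<open>ft y = 0\<close>, so the convention for the quotient does no harm.
\<close>

lemma prob_accept_region:
  assumes [measurable]: "B \<in> sets borel"
  shows "prob {\<omega> \<in> space P. (U n \<omega>, Y n \<omega>) \<in> accept_region B} = c * measure target B"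
proof -
  let ?DU = "density lborel (indicator {0<..<1}) :: real measure" and ?DY = "density lborel (\<lambda>x. ennreal (f x))"
  have "prob_space ?DU" "prob_space ?DY"
    using distributed_distr_eq_density[OF U_uniform[of n]] distributed_distr_eq_density[OF Y_density[of n]]
      prob_space_distr[of "U n" lborel] prob_space_distr[of "Y n" lborel] by auto
  then interpret D: pair_prob_space ?DU ?DY by (simp add: pair_prob_space_def pair_sigma_finite_def prob_space_imp_sigma_finite)
  interpret target: prob_space target by (rule prob_space_target)
  have "emeasure P {\<omega> \<in> space P. (U n \<omega>, Y n \<omega>) \<in> accept_region B} =
      emeasure (distr P (borel \<Otimes>\<^sub>M borel) (\<lambda>\<omega>. (U n \<omega>, Y n \<omega>))) (accept_region B)"
    by (subst emeasure_distr) (auto intro!: arg_cong2[where f=emeasure])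
  also have "\<dots> = emeasure (?DU \<Otimes>\<^sub>M ?DY) (accept_region B)"
    by (simp add: joint_law)
  also have "\<dots> = (\<integral>\<^sup>+y. emeasure ?DU ((\<lambda>u. (u, y)) -` accept_region B) \<partial>?DY)"
    by (rule D.emeasure_pair_measure_alt2) (simp cong: sets_pair_measure_cong)
  also have "\<dots> = (\<integral>\<^sup>+y. emeasure ?DU {..c * ft y / f y} * indicator B y \<partial>?DY)"
    by (intro nn_integral_cong) (auto simp: accept_region_def vimage_def atMost_def split: split_indicator)
  also have "\<dots> = (\<integral>\<^sup>+y. ennreal (f y) * (emeasure ?DU {..c * ft y / f y} * indicator B y) \<partial>lborel)"
  proof (rule nn_integral_density)
    have "(\<lambda>y. emeasure ?DU ((\<lambda>u. (u, y)) -` accept_region UNIV)) \<in> borel_measurable ?DY"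
      by (rule D.measurable_emeasure_Pair2) (simp cong: sets_pair_measure_cong)
    then show "(\<lambda>y. emeasure ?DU {..c * ft y / f y} * indicator B y) \<in> borel_measurable lborel"
      by (simp add: accept_region_def vimage_def atMost_def)
  qed simp
  also have "\<dots> = (\<integral>\<^sup>+y. ennreal c * (ennreal (ft y) * indicator B y) \<partial>lborel)"
  proof (rule nn_integral_cong_AE, rule AE_mp[OF dominated], intro AE_I2 impI)
    fix y assume le: "c * ft y \<le> f y"
    show "ennreal (f y) * (emeasure ?DU {..c * ft y / f y} * indicator B y) =
        ennreal c * (ennreal (ft y) * indicator B y)"
    proof (cases "f y = 0")
      case True
      then have "ft y = 0"
        using le c_pos ft_nonneg[of y] by (simp add: mult_le_0_iff)
      then show ?thesis using True by simp
    next
      case False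
      then have "0 < f y" using f_nonneg[of y] by simp
      then have "emeasure ?DU {..c * ft y / f y} = ennreal (c * ft y / f y)"
        using le c_pos ft_nonneg[of y] by (intro emeasure_uniform_atMost) auto
      then show ?thesis
        using \<open>0 < f y\<close> c_pos ft_nonneg[of y]
        by (simp add: mult.assoc[symmetric] ennreal_mult[symmetric])
    qed
  qed
  also have "\<dots> = ennreal c * emeasure target B"
    by (simp add: nn_integral_cmult emeasure_density)
  also have "\<dots> = ennreal (c * measure target B)"
    using c_pos by (simp add: target.emeasure_eq_measure ennreal_mult)
  finally show ?thesis
    using c_pos by (simp add: emeasure_eq_measure)
qed

lemma accepts_iff: "accepts c ft f U Y n \<omega> \<longleftrightarrow> (U n \<omega>, Y n \<omega>) \<in> accept_region UNIV"
  by (simp add: accepts_def accept_region_def)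

lemma accepts_measurable [measurable]: "Measurable.pred P (\<lambda>\<omega>. accepts c ft f U Y n \<omega>)"
  unfolding accepts_def by measurable

lemma prob_accept: "prob {\<omega> \<in> space P. accepts c ft f U Y n \<omega>} = c"
  using prob_accept_region[of UNIV n] prob_space.prob_space[OF prob_space_target]
  by (simp add: accepts_iff)

lemma c_le_1: "c \<le> 1"
  using prob_accept[of 0] prob_le_1[of "{\<omega> \<in> space P. accepts c ft f U Y 0 \<omega>}"] by simp

lemma prob_reject: "prob {\<omega> \<in> space P. \<not> accepts c ft f U Y n \<omega>} = 1 - c"
  using prob_neg[of "accepts c ft f U Y n"] by (simp add: prob_accept)

definition first_accept :: "nat \<Rightarrow> 'a set \<Rightarrow> 'p set" where
  "first_accept n B = {\<omega> \<in> space P. (\<forall>m<n. \<not> accepts c ft f U Y m \<omega>) \<and> accepts c ft f U Y n \<omega> \<and> Y n \<omega> \<in> B}"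

lemma first_accept_sets [measurable]: "B \<in> sets borel \<Longrightarrow> first_accept n B \<in> sets P"
  unfolding first_accept_def
  by (intro sets.sets_Collect_conj sets.sets_Collect_countable_All sets.sets_Collect_imp sets.sets_Collect_neg
      sets.sets_Collect_const predE accepts_measurable) (simp add: measurable_sets_borel)

lemma prob_first_accept:
  assumes [measurable]: "B \<in> sets borel"
  shows "prob (first_accept n B) = (1 - c) ^ n * (c * measure target B)"
proof -
  let ?Z = "\<lambda>n \<omega>. (U n \<omega>, Y n \<omega>)"
  \<comment> \<open>reject in the iterations before \<open>n\<close>, accept with a value in \<open>B\<close> in iteration \<open>n\<close>\<close>
  define A where "A j = (if j < n then - accept_region UNIV else accept_region B)" for j
  have A: "A j \<in> sets (borel \<Otimes>\<^sub>M borel)" for j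
  proof -
    have "space (borel \<Otimes>\<^sub>M borel) - accept_region UNIV \<in> sets (borel \<Otimes>\<^sub>M borel)" by measurable
    then show ?thesis by (auto simp: A_def space_pair_measure Compl_eq_Diff_UNIV)
  qed
  have "first_accept n B = (\<Inter>j\<in>{..n}. ?Z j -` A j \<inter> space P)"
  proof (intro set_eqI iffI)
    fix \<omega> assume "\<omega> \<in> first_accept n B"
    then show "\<omega> \<in> (\<Inter>j\<in>{..n}. ?Z j -` A j \<inter> space P)"
      by (auto simp: first_accept_def A_def accepts_def accept_region_def le_less)
  next
    fix \<omega> assume *: "\<omega> \<in> (\<Inter>j\<in>{..n}. ?Z j -` A j \<inter> space P)"
    have "?Z j \<omega> \<notin> accept_region UNIV" if "j < n" for j
      using INT_D[OF *, of j] that by (simp add: A_def)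
    moreover have "?Z n \<omega> \<in> accept_region B" "\<omega> \<in> space P"
      using INT_D[OF *, of n] by (simp_all add: A_def)
    ultimately show "\<omega> \<in> first_accept n B"
      by (auto simp: first_accept_def accepts_iff accept_region_def)
  qed
  then have "prob (first_accept n B) = (\<Prod>j\<in>{..n}. prob (?Z j -` A j \<inter> space P))"
    using A by (simp only:) (intro indep_varsD[OF indep_iterations], auto)
  also have "\<dots> = (\<Prod>j\<in>{..n}. if j < n then 1 - c else c * measure target B)"
  proof (intro prod.cong refl)
    fix j
    have "?Z j -` A j \<inter> space P = {\<omega> \<in> space P. \<not> accepts c ft f U Y j \<omega>}" if "j < n"
      using that by (auto simp: A_def accepts_iff)
    moreover have "?Z j -` A j \<inter> space P = {\<omega> \<in> space P. ?Z j \<omega> \<in> accept_region B}" if "\<not> j < n"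
      using that by (auto simp: A_def)
    ultimately show "prob (?Z j -` A j \<inter> space P) = (if j < n then 1 - c else c * measure target B)"
      by (simp add: prob_reject prob_accept_region)
  qed
  also have "\<dots> = (1 - c) ^ n * (c * measure target B)"
    by (simp add: lessThan_Suc_atMost[symmetric] lessThan_Suc)
  finally show ?thesis .
qed

lemma prob_no_accept: "prob {\<omega> \<in> space P. \<forall>m<n. \<not> accepts c ft f U Y m \<omega>} = (1 - c) ^ n"
proof (induction n)
  case (Suc n)
  have "{\<omega> \<in> space P. \<forall>m<n. \<not> accepts c ft f U Y m \<omega>} =
      {\<omega> \<in> space P. \<forall>m<Suc n. \<not> accepts c ft f U Y m \<omega>} \<union> first_accept n UNIV"
    by (auto simp: first_accept_def less_Suc_eq)
  moreover have "prob ({\<omega> \<in> space P. \<forall>m<Suc n. \<not> accepts c ft f U Y m \<omega>} \<union> first_accept n UNIV) =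
      prob {\<omega> \<in> space P. \<forall>m<Suc n. \<not> accepts c ft f U Y m \<omega>} + prob (first_accept n UNIV)"
    by (rule finite_measure_Union) (auto simp: first_accept_def)
  ultimately show ?case
    using Suc prob_first_accept[of UNIV n] prob_space.prob_space[OF prob_space_target]
    by (simp add: algebra_simps)
qed (simp add: prob_space)

text \<open>
  Summing over the index of the first acceptance gives a geometric series; its value \<open>1 / c\<close> cancels
  the acceptance probability. With \<open>B = UNIV\<close> this also shows that the procedure terminates almost
  surely.
\<close>

lemma prob_Union_first_accept:
  assumes [measurable]: "B \<in> sets borel"
  shows "prob (\<Union>n. first_accept n B) = measure target B"
proof -
  have "disjoint_family (\<lambda>n. first_accept n B)"
    unfolding disjoint_family_on_def first_accept_def
    by (auto, metis linorder_neqE_nat)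
  then have "(\<lambda>n. prob (first_accept n B)) sums prob (\<Union>n. first_accept n B)"
    by (intro finite_measure_UNION) auto
  moreover have "(\<lambda>n. (1 - c) ^ n * (c * measure target B)) sums (1 / (1 - (1 - c)) * (c * measure target B))"
    using c_pos c_le_1 by (intro sums_mult2 geometric_sums) simp
  ultimately have "prob (\<Union>n. first_accept n B) = 1 / (1 - (1 - c)) * (c * measure target B)"
    unfolding prob_first_accept[OF assms] by (rule sums_unique2)
  then show ?thesis
    using c_pos by simp
qed

lemma AE_accepts: "AE \<omega> in P. \<exists>n. accepts c ft f U Y n \<omega>"
proof -
  have "prob (\<Union>n. first_accept n UNIV) = 1"
    using prob_Union_first_accept[of UNIV] prob_space.prob_space[OF prob_space_target] by simp
  then have "AE \<omega> in P. \<omega> \<in> (\<Union>n. first_accept n UNIV)"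
    by (subst (asm) prob_eq_1) auto
  then show ?thesis by (rule AE_mp) (auto simp: first_accept_def)
qed

lemma distributed_returned_value:
  "distributed P lborel (returned_value (accepts c ft f U Y) Y) (\<lambda>x. ennreal (ft x))"
proof -
  let ?rv = "returned_value (accepts c ft f U Y) Y"
  have rv: "?rv \<in> borel_measurable P"
    unfolding returned_value_def by (rule measurable_compose_countable[where f = Y]) measurable
  interpret target: prob_space target by (rule prob_space_target)
  have "distr P lborel ?rv = target"
  proof (rule measure_eqI)
    fix B :: "'a set" assume "B \<in> sets (distr P lborel ?rv)"
    then have [measurable]: "B \<in> sets borel" by simp
    have "emeasure (distr P lborel ?rv) B = emeasure P {\<omega> \<in> space P. ?rv \<omega> \<in> B}"
      using rv by (subst emeasure_distr) (auto intro!: arg_cong2[where f=emeasure])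
    also have "\<dots> = emeasure P (\<Union>n. first_accept n B)"
    proof (rule emeasure_eq_AE)
      show "AE \<omega> in P. (\<omega> \<in> {\<omega> \<in> space P. ?rv \<omega> \<in> B}) = (\<omega> \<in> (\<Union>n. first_accept n B))"
        using AE_accepts AE_space
      proof eventually_elim
        case (elim \<omega>)
        let ?n = "LEAST n. accepts c ft f U Y n \<omega>"
        have acc: "accepts c ft f U Y ?n \<omega>" using elim(1) by (rule LeastI_ex)
        have least: "\<And>m. m < ?n \<Longrightarrow> \<not> accepts c ft f U Y m \<omega>" by (rule not_less_Least)
        have "\<omega> \<in> first_accept n B \<longleftrightarrow> n = ?n \<and> Y n \<omega> \<in> B" for n
        proof
          assume "\<omega> \<in> first_accept n B"
          then have n: "accepts c ft f U Y n \<omega>" "Y n \<omega> \<in> B" and "\<forall>m<n. \<not> accepts c ft f U Y m \<omega>"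
            by (simp_all add: first_accept_def)
          then have "\<not> ?n < n" using acc by blast
          moreover have "\<not> n < ?n" using least n(1) by blast
          ultimately show "n = ?n \<and> Y n \<omega> \<in> B" using n(2) by simp
        next
          assume "n = ?n \<and> Y n \<omega> \<in> B"
          then show "\<omega> \<in> first_accept n B"
            using elim acc least unfolding first_accept_def by blast
        qed
        then show ?case using elim by (simp add: returned_value_def)
      qed
    qed (use measurable_sets[OF rv, of B] in \<open>simp_all add: vimage_def Int_def conj_commute\<close>)
    also have "\<dots> = emeasure target B"
      by (simp add: emeasure_eq_measure target.emeasure_eq_measure prob_Union_first_accept)
    finally show "emeasure (distr P lborel ?rv) B = emeasure target B" .
  qed simp
  then show ?thesis using rv by (simp add: distributed_def)
qed

text \<open>
  Tail-sum formula: the number of iterations is the number of \<open>n\<close> such that none of the first \<open>n\<close>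
  iterations accepts, so its expectation is again a geometric series. The formula is used only where
  some iteration accepts, which is almost everywhere.
\<close>

lemma expected_num_iterations:
  "(\<integral>\<^sup>+ \<omega>. num_iterations (accepts c ft f U Y) \<omega> \<partial>P) = ennreal (1 / c)"
proof -
  let ?none = "\<lambda>n. {\<omega> \<in> space P. \<forall>m<n. \<not> accepts c ft f U Y m \<omega>}"
  have "(\<integral>\<^sup>+ \<omega>. num_iterations (accepts c ft f U Y) \<omega> \<partial>P) = (\<integral>\<^sup>+ \<omega>. (\<Sum>n. indicator (?none n) \<omega>) \<partial>P)"
  proof (rule nn_integral_cong_AE)
    show "AE \<omega> in P. num_iterations (accepts c ft f U Y) \<omega> = (\<Sum>n. indicator (?none n) \<omega>)"
      using AE_accepts AE_space
    proof eventually_elim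
      case (elim \<omega>)
      let ?n = "LEAST n. accepts c ft f U Y n \<omega>"
      have acc: "accepts c ft f U Y ?n \<omega>" using elim(1) by (rule LeastI_ex)
      have least: "\<And>m. accepts c ft f U Y m \<omega> \<Longrightarrow> ?n \<le> m" by (rule Least_le)
      have none: "\<omega> \<in> ?none n \<longleftrightarrow> n \<le> ?n" for n
        using elim acc least by (auto simp: not_less[symmetric]) (meson le_less_trans not_less)
      have "num_iterations (accepts c ft f U Y) \<omega> = of_nat (Suc ?n)"
        unfolding num_iterations_def
        by (intro antisym INF_lower2[of ?n] INF_greatest) (auto simp: acc least)
      also have "\<dots> = (\<Sum>n\<in>{..?n}. indicator (?none n) \<omega>)"
      proof -
        have "(\<Sum>n\<in>{..?n}. indicator (?none n) \<omega>) = (\<Sum>n\<in>{..?n}. 1 :: ennreal)"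
          by (intro sum.cong refl indicator_simps(1)) (simp only: none atMost_iff)
        then show ?thesis by simp
      qed
      also have "\<dots> = (\<Sum>n. indicator (?none n) \<omega>)"
        by (rule suminf_finite[symmetric]) (auto simp only: none indicator_eq_0_iff atMost_iff)
      finally show ?case .
    qed
  qed
  also have "\<dots> = (\<Sum>n. \<integral>\<^sup>+ \<omega>. indicator (?none n) \<omega> \<partial>P)"
    by (rule nn_integral_suminf) measurable
  also have "\<dots> = (\<Sum>n. ennreal ((1 - c) ^ n))"
    by (simp add: emeasure_eq_measure prob_no_accept)
  also have "\<dots> = ennreal (1 / c)"
    using geometric_sums[of "1 - c"] c_pos c_le_1 by (intro suminf_ennreal_eq) auto
  finally show ?thesis .
qed

end

theorem mainTheorem2:
  fixes A :: "real ^ 'n ^ 'n" and L :: "(real ^ 'n) measure" and b bt :: "real ^ 'n"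
    and h g :: "real ^ 'n \<Rightarrow> real" and Lt \<mu> \<mu>t :: "(real ^ 'n) measure" and \<eta> t :: real
    and M :: "'w measure" and X :: "real \<Rightarrow> 'w \<Rightarrow> real ^ 'n"
    and Mt :: "'v measure" and Xt :: "real \<Rightarrow> 'v \<Rightarrow> real ^ 'n"
    and f ft :: "real ^ 'n \<Rightarrow> real"
  assumes \<mu>: "ID_law \<mu> A L b h"
    and g_borel: "g \<in> borel_measurable borel"
    and A1: "\<And>x. 0 \<le> g x \<and> g x \<le> 1"
    and A2: "(\<integral>\<^sup>+ x. ennreal (max (norm (h x *\<^sub>R x)) 1 * (1 - g x)) \<partial>L) < \<infinity>"
    and Lt: "Lt = density L (\<lambda>x. ennreal (g x))"
    and bt: "bt = b - (LINT x|L. (h x * (1 - g x)) *\<^sub>R x)"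
    and \<mu>t: "ID_law \<mu>t A Lt bt h"
    and \<eta>: "\<eta> = (LINT x|L. 1 - g x)"
    and X: "levy_process M X" and X1: "distr M borel (X 1) = \<mu>"
    and Xt: "levy_process Mt Xt" and Xt1: "distr Mt borel (Xt 1) = \<mu>t"
    and t: "0 < t"
    and f_nonneg: "\<And>x. 0 \<le> f x" and f: "distributed M lborel (X t) (\<lambda>x. ennreal (f x))"
    and ft_nonneg: "\<And>x. 0 \<le> ft x" and ft: "distributed Mt lborel (Xt t) (\<lambda>x. ennreal (ft x))"
  shows "(AE x in lborel. ft x \<le> exp (t * \<eta>) * f x) \<and>
    (\<forall>(P :: 'p measure) U Y acc.
      rejection_inputs P U Y f \<longrightarrow> acc = accepts (exp (- \<eta> * t)) ft f U Y \<longrightarrow>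
        distributed P lborel (returned_value acc Y) (\<lambda>x. ennreal (ft x)) \<and>
        (\<forall>n. prob_space.prob P {\<omega> \<in> space P. acc n \<omega>} = exp (- \<eta> * t)) \<and>
        (\<integral>\<^sup>+ \<omega>. num_iterations acc \<omega> \<partial>P) = ennreal (exp (\<eta> * t)))"
proof -
  have g01: "0 \<le> g x" "g x \<le> 1" for x using A1 by auto
  interpret M: levy_process M X by (rule X)
  interpret Mt: levy_process Mt Xt by (rule Xt)
  have [measurable]: "f \<in> borel_measurable borel" "ft \<in> borel_measurable borel"
    using distributed_real_measurable[OF _ f] distributed_real_measurable[OF _ ft] f_nonneg ft_nonneg by auto
  have law: "distr M borel (X t) = density lborel (\<lambda>x. ennreal (f x))"
      "distr Mt borel (Xt t) = density lborel (\<lambda>x. ennreal (ft x))"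
    using distributed_distr_eq_density[OF f] distributed_distr_eq_density[OF ft] by (simp_all cong: distr_cong)
  have mass: "(\<integral>\<^sup>+x. ennreal (f x) \<partial>lborel) = 1" "(\<integral>\<^sup>+x. ennreal (ft x) \<partial>lborel) = 1"
  proof -
    have "emeasure (distr M borel (X t)) UNIV = 1" "emeasure (distr Mt borel (Xt t)) UNIV = 1"
      using t M.rv[of t] Mt.rv[of t] by (simp_all add: emeasure_distr M.emeasure_space_1 Mt.emeasure_space_1)
    then show "(\<integral>\<^sup>+x. ennreal (f x) \<partial>lborel) = 1" "(\<integral>\<^sup>+x. ennreal (ft x) \<partial>lborel) = 1"
      by (simp_all add: law emeasure_density)
  qed
  have "AE x in lborel. ennreal (ft x) \<le> ennreal (exp (t * \<eta>) * f x)"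
  proof (rule AE_le_of_emeasure_density_le)
    have "(\<integral>\<^sup>+x. ennreal (exp (t * \<eta>) * f x) \<partial>lborel) = ennreal (exp (t * \<eta>))"
      by (simp add: ennreal_mult f_nonneg nn_integral_cmult mass)
    then show "(\<integral>\<^sup>+x. ennreal (exp (t * \<eta>) * f x) \<partial>lborel) < \<infinity>" by simp
  next
    fix B :: "(real ^ 'n) set" assume "B \<in> sets lborel"
    then have [measurable]: "B \<in> sets borel" by simp
    have "ennreal (exp (- (t * \<eta>))) * emeasure (density lborel (\<lambda>x. ennreal (ft x))) B
        \<le> emeasure (density lborel (\<lambda>x. ennreal (f x))) B"
      using levy_thinning_domination[OF \<mu> g_borel g01 A2 \<mu>t[unfolded Lt bt] X X1 Xt Xt1, of t B] t
      by (simp add: law \<eta>)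
    then have "ennreal (exp (t * \<eta>)) * (ennreal (exp (- (t * \<eta>))) * emeasure (density lborel (\<lambda>x. ennreal (ft x))) B)
        \<le> ennreal (exp (t * \<eta>)) * emeasure (density lborel (\<lambda>x. ennreal (f x))) B"
      by (rule mult_left_mono) simp
    moreover have "ennreal (exp (t * \<eta>)) * (ennreal (exp (- (t * \<eta>))) * y) = y" for y
      by (simp add: mult.assoc[symmetric] ennreal_mult[symmetric] exp_minus)
    moreover have "ennreal (exp (t * \<eta>)) * emeasure (density lborel (\<lambda>x. ennreal (f x))) B
        = emeasure (density lborel (\<lambda>x. ennreal (exp (t * \<eta>) * f x))) B"
      by (simp add: emeasure_density ennreal_mult f_nonneg mult.assoc nn_integral_cmult)
    ultimately show "emeasure (density lborel (\<lambda>x. ennreal (ft x))) B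
        \<le> emeasure (density lborel (\<lambda>x. ennreal (exp (t * \<eta>) * f x))) B" by simp
  qed simp_all
  then have dom: "AE x in lborel. ft x \<le> exp (t * \<eta>) * f x"
    by (simp add: f_nonneg ennreal_le_iff)
  moreover have "distributed P lborel (returned_value acc Y) (\<lambda>x. ennreal (ft x)) \<and>
      (\<forall>n. prob_space.prob P {\<omega> \<in> space P. acc n \<omega>} = exp (- \<eta> * t)) \<and>
      (\<integral>\<^sup>+ \<omega>. num_iterations acc \<omega> \<partial>P) = ennreal (exp (\<eta> * t))"
    if inputs: "rejection_inputs P U Y f" and acc: "acc = accepts (exp (- \<eta> * t)) ft f U Y"
    for P :: "'p measure" and U Y acc
  proof -
    have "AE x in lborel. exp (- \<eta> * t) * ft x \<le> f x"
      using dom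
    proof eventually_elim
      case (elim x)
      then have "exp (- \<eta> * t) * ft x \<le> exp (- \<eta> * t) * (exp (t * \<eta>) * f x)"
        by (intro mult_left_mono) auto
      also have "\<dots> = f x" by (simp add: mult.assoc[symmetric] exp_add[symmetric] mult.commute[of \<eta>])
      finally show ?case .
    qed
    then interpret rejection_sampling P U Y f ft "exp (- \<eta> * t)"
      using inputs by (intro rejection_sampling.intro rejection_sampling_axioms.intro)
        (auto simp: f_nonneg ft_nonneg mass)
    show ?thesis
      unfolding acc using distributed_returned_value prob_accept expected_num_iterations
      by (simp add: exp_minus inverse_eq_divide)
  qed
  ultimately show ?thesis by blast
qed

end
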